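(* Let $f:\omega\to\omega$ be not effectively densely computable. Then $\mu(\{X\subseteq\omega : f \text{ is effectively densely computable relative to } X\})=0$; indeed, no element of this class is weakly $3$-random relative to $f$. Consequently, for every set $A\subseteq\omega$ that is not effectively densely computable, the classes $\{X : A\le_{\mathrm{ued}} X\}$ and $\{X: A\le_{\mathrm{ned}} X\}$ have measure $0$.
   Context: $\mu$ is Lebesgue (fair-coin) measure on $2^\omega$, identifying sets with their characteristic sequences. For $A\subseteq\omega$, $\rho_n(A)=|A\cap\{0,\dots,n-1\}|/n$ and $\rho(A)=\lim_n\rho_n(A)$ when it exists. An effective dense description of $g:\omega\to\omega$ is a total function $d:\omega\to\omega\cup\{\square\}$ (with $\square$ a fixed symbol not in $\omega$) such that $d(n)=g(n)$ whenever $d(n)\neq\square$, and $\rho(\{n: d(n)\ne\square\})=1$. $g$ is effectively densely computable (relative to $X$) if it has a computable ($X$-computable) effective dense description. A set $X$ is weakly $n$-random relative to $Z$ if $X$ lies in no $\Pi^{0,Z}_n$ class of measure $0$. $h\le_{\mathrm{ned}} g$ means every effective dense description of $g$ computes an effective dense description of $h$; $h\le_{\mathrm{ued}} g$ means there is a Turing functional $\Phi$ such that $\Phi^d$ is an effective dense description of $h$ for every effective dense description $d$ of $g$. Sets are identified with their characteristic functions. *)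

theory Defs
  imports "HOL-Probability.Probability"
begin

text \<open>
  Relative computation is modelled by Kleene's \<open>\<mu>\<close>-recursive functions with an additional
  basic function \<open>PQuery\<close>, which queries the function relative to which one computes.  Programs do
  not mention a particular such function, so they are at the same time indices of Turing functionals.
\<close>

datatype prog =
    PZero
  | PSucc
  | PProj nat
  | PQuery
  | PComp prog "prog list"
  | PRec prog prog
  | PMu prog

text \<open>
  \<open>runs g p xs y\<close>: program \<open>p\<close>, computing relative to \<open>g\<close>, halts on the arguments \<open>xs\<close> with output \<open>y\<close>.
  The recursion and minimisation variable is the first argument.
\<close>

inductive runs :: "(nat \<Rightarrow> nat) \<Rightarrow> prog \<Rightarrow> nat list \<Rightarrow> nat \<Rightarrow> bool" for g where
  zero: "runs g PZero xs 0"
| succ: "runs g PSucc [x] (Suc x)"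
| proj: "i < length xs \<Longrightarrow> runs g (PProj i) xs (xs ! i)"
| query: "runs g PQuery [x] (g x)"
| comp: "list_all2 (\<lambda>q y. runs g q xs y) qs ys \<Longrightarrow> runs g p ys z \<Longrightarrow> runs g (PComp p qs) xs z"
| rec_0: "runs g p xs y \<Longrightarrow> runs g (PRec p q) (0 # xs) y"
| rec_Suc: "runs g (PRec p q) (n # xs) r \<Longrightarrow> runs g q (n # r # xs) y \<Longrightarrow>
    runs g (PRec p q) (Suc n # xs) y"
| mu: "runs g p (n # xs) 0 \<Longrightarrow> (\<forall>i<n. \<exists>y. runs g p (i # xs) (Suc y)) \<Longrightarrow> runs g (PMu p) xs n"

inductive_cases runs_elims:
  "runs g PZero xs y"
  "runs g PSucc xs y"
  "runs g (PProj i) xs y"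
  "runs g PQuery xs y"
  "runs g (PComp p qs) xs y"
  "runs g (PRec p q) (0 # xs) y"
  "runs g (PRec p q) (Suc n # xs) y"
  "runs g (PMu p) xs y"

lemma runs_deterministic: "runs g p xs y \<Longrightarrow> runs g p xs z \<Longrightarrow> y = z"
proof (induction arbitrary: z rule: runs.induct)
  case (comp xs qs ys p w)
  from comp.prems obtain zs where zs: "list_all2 (\<lambda>q y. runs g q xs y) qs zs" "runs g p zs z"
    by (rule runs_elims(5))
  have "ys = zs"
    using comp.IH(1) zs(1) unfolding list_all2_conv_all_nth
    by (auto intro!: nth_equalityI)
  with comp.IH(2) zs(2) show ?case by simp
next
  case (rec_Suc p q n xs r y)
  from rec_Suc.prems obtain r' where "runs g (PRec p q) (n # xs) r'" "runs g q (n # r' # xs) z"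
    by (rule runs_elims(7))
  with rec_Suc.IH show ?case by blast
next
  case (mu p n xs)
  from mu.prems have z: "runs g p (z # xs) 0" and z': "\<forall>i<z. \<exists>y. runs g p (i # xs) (Suc y)"
    by (blast elim: runs_elims(8))+
  have "\<not> z < n" using mu.IH(2) z by (metis nat.distinct(1))
  moreover have "\<not> n < z" using mu.IH(1) z' by (metis nat.distinct(1))
  ultimately show ?case by simp
next
  case (rec_0 p xs y q)
  then show ?case by (blast elim: runs_elims(6))
next
  case zero
  then show ?case by (rule runs_elims(1)) simp
next
  case succ
  then show ?case by (rule runs_elims(2)) simp
next
  case proj
  from proj.prems show ?case by (rule runs_elims(3)) simp
next
  case query
  then show ?case by (rule runs_elims(4)) simp
qed

definition computes :: "(nat \<Rightarrow> nat) \<Rightarrow> prog \<Rightarrow> (nat \<Rightarrow> nat) \<Rightarrow> bool" where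
  "computes g p h \<longleftrightarrow> (\<forall>n. runs g p [n] (h n))"

definition computable_in :: "(nat \<Rightarrow> nat) \<Rightarrow> (nat \<Rightarrow> nat) \<Rightarrow> bool" where
  "computable_in g h \<longleftrightarrow> (\<exists>p. computes g p h)"

fun query_free :: "prog \<Rightarrow> bool" where
  "query_free PZero = True"
| "query_free PSucc = True"
| "query_free (PProj i) = True"
| "query_free PQuery = False"
| "query_free (PComp p qs) = (query_free p \<and> (\<forall>q\<in>set qs. query_free q))"
| "query_free (PRec p q) = (query_free p \<and> query_free q)"
| "query_free (PMu p) = query_free p"

definition computable :: "(nat \<Rightarrow> nat) \<Rightarrow> bool" where
  "computable h \<longleftrightarrow> (\<exists>p. query_free p \<and> (\<forall>g. computes g p h))"

abbreviation char_fun :: "nat set \<Rightarrow> nat \<Rightarrow> nat" where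
  "char_fun X \<equiv> indicator X"

definition join :: "(nat \<Rightarrow> nat) \<Rightarrow> (nat \<Rightarrow> nat) \<Rightarrow> nat \<Rightarrow> nat" where
  "join g h n = (if even n then g (n div 2) else h (n div 2))"


definition partial_density :: "nat \<Rightarrow> nat set \<Rightarrow> real" where
  "partial_density n A = real (card (A \<inter> {0..<n})) / real n"

definition has_density :: "nat set \<Rightarrow> real \<Rightarrow> bool" where
  "has_density A r \<longleftrightarrow> (\<lambda>n. partial_density n A) \<longlonglongrightarrow> r"

text \<open>
  The value \<open>None\<close> plays the role of the symbol \<open>\<box>\<close>.  As oracles and as outputs of programs,
  functions into \<open>\<omega> \<union> {\<box>}\<close> are coded by functions into \<open>\<omega>\<close>.
\<close>

definition eff_dense_desc :: "(nat \<Rightarrow> nat) \<Rightarrow> (nat \<Rightarrow> nat option) \<Rightarrow> bool" where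
  "eff_dense_desc g d \<longleftrightarrow>
     (\<forall>n. d n \<noteq> None \<longrightarrow> d n = Some (g n)) \<and> has_density {n. d n \<noteq> None} 1"

definition code_desc :: "(nat \<Rightarrow> nat option) \<Rightarrow> nat \<Rightarrow> nat" where
  "code_desc d n = (case d n of None \<Rightarrow> 0 | Some k \<Rightarrow> Suc k)"

definition eff_dense_computable :: "(nat \<Rightarrow> nat) \<Rightarrow> bool" where
  "eff_dense_computable g \<longleftrightarrow> (\<exists>d. eff_dense_desc g d \<and> computable (code_desc d))"

definition eff_dense_computable_in :: "nat set \<Rightarrow> (nat \<Rightarrow> nat) \<Rightarrow> bool" where
  "eff_dense_computable_in X g \<longleftrightarrow>
     (\<exists>d. eff_dense_desc g d \<and> computable_in (char_fun X) (code_desc d))"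

definition ned_le :: "(nat \<Rightarrow> nat) \<Rightarrow> (nat \<Rightarrow> nat) \<Rightarrow> bool" (infix \<open>\<le>\<^sub>n\<^sub>e\<^sub>d\<close> 50) where
  "h \<le>\<^sub>n\<^sub>e\<^sub>d g \<longleftrightarrow>
     (\<forall>d. eff_dense_desc g d \<longrightarrow>
        (\<exists>d'. eff_dense_desc h d' \<and> computable_in (code_desc d) (code_desc d')))"

definition ued_le :: "(nat \<Rightarrow> nat) \<Rightarrow> (nat \<Rightarrow> nat) \<Rightarrow> bool" (infix \<open>\<le>\<^sub>u\<^sub>e\<^sub>d\<close> 50) where
  "h \<le>\<^sub>u\<^sub>e\<^sub>d g \<longleftrightarrow>
     (\<exists>\<Phi>. \<forall>d. eff_dense_desc g d \<longrightarrow>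
        (\<exists>d'. eff_dense_desc h d' \<and> computes (code_desc d) \<Phi> (code_desc d')))"


text \<open>
  The completion matters: the classes of sets above a given one under the two reducibilities
  are not evidently Borel.
\<close>

definition cantor_measure :: "nat set measure" where
  "cantor_measure =
     completion (embed_measure (\<Pi>\<^sub>M n\<in>UNIV. measure_pmf (bernoulli_pmf (1/2))) Collect)"

definition decides :: "(nat \<Rightarrow> nat) \<Rightarrow> prog \<Rightarrow> nat \<Rightarrow> (nat list \<Rightarrow> bool) \<Rightarrow> bool" where
  "decides g p n R \<longleftrightarrow> (\<forall>ks. length ks = n \<longrightarrow> runs g p ks (of_bool (R ks)))"

text \<open>
  \<open>alternating n b R\<close> prefixes the \<open>n\<close>-ary relation \<open>R\<close> with \<open>n\<close> alternating number quantifiers,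
  the outermost one being universal iff \<open>b\<close> is true.
\<close>

primrec alternating :: "nat \<Rightarrow> bool \<Rightarrow> (nat list \<Rightarrow> bool) \<Rightarrow> bool" where
  "alternating 0 b R = R []"
| "alternating (Suc n) b R =
     (if b then \<forall>k. alternating n False (\<lambda>ks. R (k # ks))
      else \<exists>k. alternating n True (\<lambda>ks. R (k # ks)))"

definition Pi_class :: "nat \<Rightarrow> (nat \<Rightarrow> nat) \<Rightarrow> nat set set \<Rightarrow> bool" where
  "Pi_class n Z C \<longleftrightarrow>
     (\<exists>p R. (\<forall>X. decides (join (char_fun X) Z) p n (R X)) \<and> C = {X. alternating n True (R X)})"

definition weakly_random :: "nat \<Rightarrow> (nat \<Rightarrow> nat) \<Rightarrow> nat set \<Rightarrow> bool" where
  "weakly_random n Z X \<longleftrightarrow> (\<forall>C. Pi_class n Z C \<and> C \<in> null_sets cantor_measure \<longrightarrow> X \<notin> C)"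

end

theory Submission
  imports Defs
begin

text \<open>
  For a program \<open>p\<close>, the class of all \<open>X\<close> relative to which \<open>p\<close> computes an effective dense description
  of \<open>f\<close> is \<open>\<Pi>\<^sub>3\<close> relative to \<open>f\<close>, and it suffices to show that it is null.  Otherwise it fills more than
  \<open>7/8\<close> of some clopen set \<open>K\<close>.  Given \<open>n\<close>, search for a value that \<open>p\<close> outputs on \<open>n\<close> for more than a
  quarter of the oracles in \<open>K\<close>; one exists because on the class only \<open>\<box>\<close> and \<open>f n\<close> occur.  The value
  found is output for more than an eighth of \<open>K\<close> within the class, so it is \<open>\<box>\<close> or \<open>f n\<close>.  Since the
  density of the \<open>\<box>\<close>-places tends to \<open>0\<close> on the class, so does its integral, and hence \<open>\<box>\<close> is found
  only on a set of density \<open>0\<close>: \<open>f\<close> is effectively densely computable.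
\<close>

section \<open>Total recursive functionals\<close>

text \<open>The class is \<Pi>_3 relative to \<open>f\<close>, so a computation of \<open>f\<close>
  cannot sample from it. A clopen \<open>K\<close> can be sampled: it is a finite table, and
  although it is chosen noneffectively, a program may contain it as a constant. The price is the
  part of \<open>K\<close> outside the class, where \<open>p\<close> may diverge or err. The
  constants absorb it. Inside the class only two outputs compete, so one of them occupies more than
  7/16 of \<open>K\<close>, well above the threshold 1/4; and 1/4 still exceeds the share 1/8 of bad
  oracles, so these alone cannot lift a wrong value over the threshold. Since the threshold is
  strict, it is passed at a finite stage, which makes the search effective. Programs have to be
  evaluated in two settings: relative to the join of \<open>X\<close> and \<open>f\<close>, to place
  the class in the hierarchy, and on finite binary strings without any oracle, for the vote. One
  bounded evaluator, parametrised by the way in which oracle values are read, serves both; this is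
  why the closure properties below carry a flag for queries.\<close>

text \<open>The flag \<open>b\<close> permits queries; with \<open>b = False\<close> the program is query-free.\<close>

definition total_rec :: "bool \<Rightarrow> nat \<Rightarrow> ((nat \<Rightarrow> nat) \<Rightarrow> nat list \<Rightarrow> nat) \<Rightarrow> bool" where
  "total_rec b n F \<longleftrightarrow>
     (\<exists>p. (b \<or> query_free p) \<and> (\<forall>g xs. length xs = n \<longrightarrow> runs g p xs (F g xs)))"

abbreviation decidable_rel :: "bool \<Rightarrow> nat \<Rightarrow> ((nat \<Rightarrow> nat) \<Rightarrow> nat list \<Rightarrow> bool) \<Rightarrow> bool" where
  "decidable_rel b n P \<equiv> total_rec b n (\<lambda>g xs. of_bool (P g xs))"

lemma total_rec_cong:
  assumes "total_rec b n F" "\<And>g xs. length xs = n \<Longrightarrow> G g xs = F g xs"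
  shows "total_rec b n G"
  using assms unfolding total_rec_def by metis

lemma total_rec_proj: "i < n \<Longrightarrow> total_rec b n (\<lambda>g xs. xs ! i)"
  unfolding total_rec_def by (rule exI[of _ "PProj i"]) (auto intro: runs.proj)

lemma total_rec_compose:
  assumes F: "total_rec b (length As) F" and As: "\<And>A. A \<in> set As \<Longrightarrow> total_rec b n A"
  shows "total_rec b n (\<lambda>g xs. F g (map (\<lambda>A. A g xs) As))"
proof -
  obtain p where p: "b \<or> query_free p" "\<And>g xs. length xs = length As \<Longrightarrow> runs g p xs (F g xs)"
    using F unfolding total_rec_def by blast
  have "\<forall>A\<in>set As. \<exists>q. (b \<or> query_free q) \<and> (\<forall>g xs. length xs = n \<longrightarrow> runs g q xs (A g xs))"
    using As unfolding total_rec_def by blast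
  then obtain q where q: "\<And>A. A \<in> set As \<Longrightarrow> b \<or> query_free (q A)"
    "\<And>A g xs. A \<in> set As \<Longrightarrow> length xs = n \<Longrightarrow> runs g (q A) xs (A g xs)"
    by metis
  have "runs g (PComp p (map q As)) xs (F g (map (\<lambda>A. A g xs) As))" if "length xs = n" for g xs
    by (rule runs.comp[of _ _ _ "map (\<lambda>A. A g xs) As"])
      (auto simp: list_all2_conv_all_nth intro!: p(2) q(2) that)
  moreover have "b \<or> query_free (PComp p (map q As))" using p(1) q(1) by auto
  ultimately show ?thesis unfolding total_rec_def by blast
qed

text \<open>Recursion and bounded operators push new variables to the front of the argument list;
  composing with projections selects the arguments of a given functional from the longer
  list.\<close>

lemma total_rec_reindex:
  assumes "total_rec b m F" "length js = m" "\<And>j. j \<in> set js \<Longrightarrow> j < n"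
  shows "total_rec b n (\<lambda>g xs. F g (map ((!) xs) js))"
proof -
  have "total_rec b n (\<lambda>g xs. F g (map (\<lambda>A. A g xs) (map (\<lambda>j g xs. xs ! j) js)))"
    by (rule total_rec_compose) (use assms in \<open>auto intro: total_rec_proj\<close>)
  then show ?thesis by (simp add: comp_def)
qed

lemma total_rec_compose1:
  assumes "total_rec b 1 F" "total_rec b n A"
  shows "total_rec b n (\<lambda>g xs. F g [A g xs])"
  using total_rec_compose[of b "[A]" F n] assms by simp

lemma total_rec_compose2:
  assumes "total_rec b 2 F" "total_rec b n A" "total_rec b n B"
  shows "total_rec b n (\<lambda>g xs. F g [A g xs, B g xs])"
  using total_rec_compose[of b "[A, B]" F n] assms by (auto simp: numeral_2_eq_2)

lemma total_rec_Suc: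
  assumes "total_rec b n A"
  shows "total_rec b n (\<lambda>g xs. Suc (A g xs))"
proof -
  have "total_rec b 1 (\<lambda>g xs. Suc (xs ! 0))"
    unfolding total_rec_def
    by (rule exI[of _ PSucc]) (auto simp: length_Suc_conv intro: runs.succ)
  from total_rec_compose1[OF this assms] show ?thesis by simp
qed

lemma total_rec_query:
  assumes "total_rec True n A"
  shows "total_rec True n (\<lambda>g xs. g (A g xs))"
proof -
  have "total_rec True 1 (\<lambda>g xs. g (xs ! 0))"
    unfolding total_rec_def
    by (rule exI[of _ PQuery]) (auto simp: length_Suc_conv intro: runs.query)
  from total_rec_compose1[OF this assms] show ?thesis by simp
qed

lemma total_rec_const: "total_rec b n (\<lambda>g xs. c)"
proof (induction c)
  case 0
  show ?case unfolding total_rec_def by (rule exI[of _ PZero]) (auto intro: runs.zero)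
next
  case (Suc c)
  then show ?case by (rule total_rec_Suc)
qed

lemma total_rec_prim_rec:
  assumes F: "total_rec b n F" and H: "total_rec b (Suc (Suc n)) H" and B: "total_rec b n B"
  shows "total_rec b n (\<lambda>g xs. rec_nat (F g xs) (\<lambda>i r. H g (i # r # xs)) (B g xs))"
proof -
  obtain p where p: "b \<or> query_free p" "\<And>g xs. length xs = n \<Longrightarrow> runs g p xs (F g xs)"
    using F unfolding total_rec_def by blast
  obtain q where q: "b \<or> query_free q"
    "\<And>g xs. length xs = Suc (Suc n) \<Longrightarrow> runs g q xs (H g xs)"
    using H unfolding total_rec_def by blast
  have "runs g (PRec p q) (k # xs) (rec_nat (F g xs) (\<lambda>i r. H g (i # r # xs)) k)"
    if "length xs = n" for g k xs
    by (induction k) (auto intro!: p(2) q(2) intro: runs.rec_0 runs.rec_Suc simp: that)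
  then have "total_rec b (Suc n)
      (\<lambda>g xs. rec_nat (F g (tl xs)) (\<lambda>i r. H g (i # r # tl xs)) (hd xs))"
    unfolding total_rec_def using p(1) q(1)
    by (intro exI[of _ "PRec p q"]) (auto simp: length_Suc_conv)
  then have "total_rec b n (\<lambda>g xs. (\<lambda>g xs. rec_nat (F g (tl xs))
      (\<lambda>i r. H g (i # r # tl xs)) (hd xs)) g (map (\<lambda>A. A g xs) (B # map (\<lambda>j g xs. xs ! j) [0..<n])))"
    by (intro total_rec_compose) (auto intro: B total_rec_proj)
  then show ?thesis
    by (rule total_rec_cong) (auto simp: comp_def map_nth)
qed

text \<open>\<open>runs.mu\<close> demands convergent positive values before the first zero.
  Totality of \<open>F\<close> supplies them, and \<open>ex\<close> guarantees the zero.\<close>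

lemma total_rec_mu:
  assumes F: "total_rec b (Suc n) F"
    and ex: "\<And>g xs. length xs = n \<Longrightarrow> \<exists>k. F g (k # xs) = 0"
  shows "total_rec b n (\<lambda>g xs. LEAST k. F g (k # xs) = 0)"
proof -
  obtain p where p: "b \<or> query_free p" "\<And>g xs. length xs = Suc n \<Longrightarrow> runs g p xs (F g xs)"
    using F unfolding total_rec_def by blast
  have "runs g (PMu p) xs (LEAST k. F g (k # xs) = 0)" if xs: "length xs = n" for g xs
  proof (rule runs.mu)
    let ?k = "LEAST k. F g (k # xs) = 0"
    have "F g (?k # xs) = 0" using ex[OF xs] by (rule LeastI_ex)
    then show "runs g p (?k # xs) 0" using p(2)[of "?k # xs" g] xs by simp
    show "\<forall>i<?k. \<exists>y. runs g p (i # xs) (Suc y)"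
    proof (intro allI impI)
      fix i assume "i < ?k"
      then have "F g (i # xs) \<noteq> 0" by (rule not_less_Least)
      then show "\<exists>y. runs g p (i # xs) (Suc y)"
        using p(2)[of "i # xs" g] xs by (metis length_Cons not0_implies_Suc)
    qed
  qed
  then show ?thesis unfolding total_rec_def using p(1) by (intro exI[of _ "PMu p"]) auto
qed

lemma total_rec_add:
  assumes "total_rec b n A" "total_rec b n B"
  shows "total_rec b n (\<lambda>g xs. A g xs + B g xs)"
proof -
  \<comment> \<open>The redex displays the step as a functional applied to
    \<open>i # r # xs\<close>, the form that \<open>total_rec_prim_rec\<close> expects: position 0
    is the counter, position 1 the previous value.\<close>
  have "total_rec b 2 (\<lambda>g xs. rec_nat (xs ! 0) (\<lambda>i r. (\<lambda>g ys. Suc (ys ! 1)) g (i # r # xs)) (xs ! 1))"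
    by (intro total_rec_prim_rec total_rec_Suc total_rec_proj) auto
  moreover have "rec_nat a (\<lambda>i. Suc) k = a + k" for a k by (induction k) auto
  ultimately have "total_rec b 2 (\<lambda>g xs. xs ! 0 + xs ! 1)" by simp
  from total_rec_compose2[OF this assms] show ?thesis by simp
qed

lemma total_rec_mult:
  assumes "total_rec b n A" "total_rec b n B"
  shows "total_rec b n (\<lambda>g xs. A g xs * B g xs)"
proof -
  have "total_rec b 2 (\<lambda>g xs. rec_nat 0 (\<lambda>i r. (\<lambda>g ys. ys ! 1 + ys ! 2) g (i # r # xs)) (xs ! 1))"
    by (intro total_rec_prim_rec total_rec_add total_rec_const total_rec_proj) auto
  moreover have "rec_nat 0 (\<lambda>i r. r + a) k = a * k" for a k :: nat by (induction k) auto
  ultimately have "total_rec b 2 (\<lambda>g xs. xs ! 0 * xs ! 1)" by simp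
  from total_rec_compose2[OF this assms] show ?thesis by simp
qed

lemma total_rec_pred:
  assumes "total_rec b n A"
  shows "total_rec b n (\<lambda>g xs. A g xs - 1)"
proof -
  have "total_rec b 1 (\<lambda>g xs. rec_nat 0 (\<lambda>i r. (\<lambda>g ys. ys ! 0) g (i # r # xs)) (xs ! 0))"
    by (intro total_rec_prim_rec total_rec_const total_rec_proj) auto
  moreover have "rec_nat 0 (\<lambda>i r. i) k = k - 1" for k :: nat by (induction k) auto
  ultimately have "total_rec b 1 (\<lambda>g xs. xs ! 0 - 1)" by simp
  from total_rec_compose1[OF this assms] show ?thesis by simp
qed

lemma total_rec_diff:
  assumes "total_rec b n A" "total_rec b n B"
  shows "total_rec b n (\<lambda>g xs. A g xs - B g xs)"
proof -
  have "total_rec b 2 (\<lambda>g xs. rec_nat (xs ! 0) (\<lambda>i r. (\<lambda>g ys. ys ! 1 - 1) g (i # r # xs)) (xs ! 1))"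
    by (intro total_rec_prim_rec total_rec_pred total_rec_const total_rec_proj) auto
  moreover have "rec_nat a (\<lambda>i r. r - 1) k = a - k" for a k :: nat by (induction k) auto
  ultimately have "total_rec b 2 (\<lambda>g xs. xs ! 0 - xs ! 1)" by simp
  from total_rec_compose2[OF this assms] show ?thesis by simp
qed

lemma total_rec_power:
  assumes "total_rec b n A"
  shows "total_rec b n (\<lambda>g xs. c ^ A g xs)"
proof -
  have "total_rec b 1 (\<lambda>g xs. rec_nat 1 (\<lambda>i r. (\<lambda>g ys. c * ys ! 1) g (i # r # xs)) (xs ! 0))"
    by (intro total_rec_prim_rec total_rec_mult total_rec_const total_rec_proj) auto
  moreover have "rec_nat 1 (\<lambda>i r. c * r) k = c ^ k" for k :: nat by (induction k) auto
  ultimately have "total_rec b 1 (\<lambda>g xs. c ^ (xs ! 0))" by simp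
  from total_rec_compose1[OF this assms] show ?thesis by simp
qed

lemma total_rec_sum:
  assumes "total_rec b (Suc n) F" "total_rec b n B"
  shows "total_rec b n (\<lambda>g xs. \<Sum>i<B g xs. F g (i # xs))"
proof -
  \<comment> \<open>The recursion step sees \<open>i # r # xs\<close>; the index list keeps
    \<open>i\<close> and \<open>xs\<close> and drops the accumulator \<open>r\<close>.\<close>
  have "total_rec b (Suc (Suc n)) (\<lambda>g ys. F g (map ((!) ys) (0 # [2..<Suc (Suc n)])))"
    by (rule total_rec_reindex[OF assms(1)]) auto
  then have "total_rec b n (\<lambda>g xs. rec_nat 0 (\<lambda>i r.
      (\<lambda>g ys. ys ! 1 + F g (map ((!) ys) (0 # [2..<Suc (Suc n)]))) g (i # r # xs)) (B g xs))"
    by (intro total_rec_prim_rec total_rec_add total_rec_const total_rec_proj assms(2)) auto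
  moreover have "rec_nat 0 (\<lambda>i r. r + F g (i # map ((!) (i # r # xs)) [2..<Suc (Suc n)])) k
      = (\<Sum>i<k. F g (i # xs))" if "length xs = n" for g xs k
  proof -
    have "map ((!) (i # r # xs)) [2..<Suc (Suc n)] = xs" for i r
      by (rule nth_equalityI) (use that in \<open>auto simp del: upt_Suc\<close>)
    then show ?thesis by (induction k) auto
  qed
  ultimately show ?thesis
    by (elim total_rec_cong) (simp del: upt_Suc)
qed

lemma decidable_rel_le:
  assumes "total_rec b n A" "total_rec b n B"
  shows "decidable_rel b n (\<lambda>g xs. A g xs \<le> B g xs)"
proof -
  have "total_rec b n (\<lambda>g xs. 1 - (A g xs - B g xs))"
    by (intro total_rec_diff total_rec_const assms)
  then show ?thesis by (rule total_rec_cong) auto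
qed

lemma decidable_rel_less:
  assumes "total_rec b n A" "total_rec b n B"
  shows "decidable_rel b n (\<lambda>g xs. A g xs < B g xs)"
  using decidable_rel_le[OF total_rec_Suc[OF assms(1)] assms(2)] by (simp add: Suc_le_eq)

lemma decidable_rel_not:
  assumes "decidable_rel b n P"
  shows "decidable_rel b n (\<lambda>g xs. \<not> P g xs)"
proof -
  have "total_rec b n (\<lambda>g xs. 1 - of_bool (P g xs))"
    by (intro total_rec_diff total_rec_const assms)
  then show ?thesis by (rule total_rec_cong) auto
qed

lemma decidable_rel_conj:
  assumes "decidable_rel b n P" "decidable_rel b n Q"
  shows "decidable_rel b n (\<lambda>g xs. P g xs \<and> Q g xs)"
  using total_rec_mult[OF assms] by (simp add: of_bool_conj)

lemma decidable_rel_disj: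
  assumes "decidable_rel b n P" "decidable_rel b n Q"
  shows "decidable_rel b n (\<lambda>g xs. P g xs \<or> Q g xs)"
  using decidable_rel_not[OF decidable_rel_conj[OF decidable_rel_not[OF assms(1)]
    decidable_rel_not[OF assms(2)]]] by simp

lemma decidable_rel_imp:
  assumes "decidable_rel b n P" "decidable_rel b n Q"
  shows "decidable_rel b n (\<lambda>g xs. P g xs \<longrightarrow> Q g xs)"
  using decidable_rel_disj[OF decidable_rel_not[OF assms(1)] assms(2)] by simp

lemma decidable_rel_eq:
  assumes "total_rec b n A" "total_rec b n B"
  shows "decidable_rel b n (\<lambda>g xs. A g xs = B g xs)"
  by (rule total_rec_cong[OF
        decidable_rel_conj[OF decidable_rel_le[OF assms] decidable_rel_le[OF assms(2,1)]]]) auto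

text \<open>The sum counts the counterexamples below the bound, so the quantifier becomes a test for
  zero.\<close>

lemma decidable_rel_ball:
  assumes "decidable_rel b (Suc n) P" "total_rec b n B"
  shows "decidable_rel b n (\<lambda>g xs. \<forall>i<B g xs. P g (i # xs))"
proof -
  have "decidable_rel b n (\<lambda>g xs. (\<Sum>i<B g xs. (\<lambda>g ys. of_bool (\<not> P g ys)) g (i # xs)) = (0::nat))"
    by (intro decidable_rel_eq total_rec_sum decidable_rel_not total_rec_const assms)
  then show ?thesis by (rule total_rec_cong) (auto simp: sum_eq_0_iff)
qed

lemma decidable_rel_bex:
  assumes "decidable_rel b (Suc n) P" "total_rec b n B"
  shows "decidable_rel b n (\<lambda>g xs. \<exists>i<B g xs. P g (i # xs))"
  using decidable_rel_not[OF decidable_rel_ball[OF decidable_rel_not[OF assms(1)] assms(2)]] by simp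

lemma total_rec_if:
  assumes "decidable_rel b n P" "total_rec b n A" "total_rec b n B"
  shows "total_rec b n (\<lambda>g xs. if P g xs then A g xs else B g xs)"
proof -
  have "total_rec b n (\<lambda>g xs. of_bool (P g xs) * A g xs + of_bool (\<not> P g xs) * B g xs)"
    by (intro total_rec_add total_rec_mult decidable_rel_not assms)
  then show ?thesis by (rule total_rec_cong) auto
qed

text \<open>The bit at position \<open>i\<close> is the parity of the quotient by
  \<open>2 ^ i\<close>, and that quotient arises by halving \<open>i\<close> times. Hence parity and
  halving suffice.\<close>

lemma decidable_rel_bit:
  assumes "total_rec b n A" "total_rec b n B"
  shows "decidable_rel b n (\<lambda>g xs. bit (A g xs) (B g xs))"
proof -
  have odd1: "decidable_rel b 1 (\<lambda>g xs. odd (xs ! 0))"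
  proof -
    have "total_rec b 1 (\<lambda>g xs. rec_nat 0 (\<lambda>i r. (\<lambda>g ys. 1 - ys ! 1) g (i # r # xs)) (xs ! 0))"
      by (intro total_rec_prim_rec total_rec_diff total_rec_const total_rec_proj) auto
    moreover have "rec_nat 0 (\<lambda>i r. 1 - r) k = (of_bool (odd k) :: nat)" for k
      by (induction k) auto
    ultimately show ?thesis by simp
  qed
  have half1: "total_rec b 1 (\<lambda>g xs. xs ! 0 div 2)"
  proof -
    have "total_rec b 2 (\<lambda>g ys. (\<lambda>g xs. of_bool (odd (xs ! 0))) g [ys ! 0])"
      by (intro total_rec_compose1[OF odd1] total_rec_proj) auto
    then have "total_rec b 1 (\<lambda>g xs. \<Sum>i<xs ! 0. (\<lambda>g ys. of_bool (odd (ys ! 0))) g (i # xs))"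
      by (intro total_rec_sum total_rec_proj) (simp_all add: numeral_2_eq_2)
    \<comment> \<open>Half of \<open>k\<close> is obtained as the number of odd numbers below
      \<open>k\<close>.\<close>
    moreover have "(\<Sum>i<k. of_bool (odd i)) = k div 2" for k :: nat
      by (induction k) auto
    ultimately show ?thesis by simp
  qed
  have "total_rec b 4 (\<lambda>g ys. (\<lambda>g xs. xs ! 0 div 2) g [ys ! 1])"
    by (intro total_rec_compose1[OF half1] total_rec_proj) auto
  then have "total_rec b 2 (\<lambda>g xs. rec_nat (xs ! 0) (\<lambda>i r. (\<lambda>g ys. ys ! 1 div 2) g (i # r # xs)) (xs ! 1))"
    by (intro total_rec_prim_rec total_rec_proj) (simp_all add: eval_nat_numeral)
  moreover have "rec_nat a (\<lambda>i r. r div 2) k = a div 2 ^ k" for a k :: nat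
    by (induction k) (simp_all add: div_mult2_eq[symmetric] mult.commute)
  ultimately have "total_rec b 2 (\<lambda>g xs. xs ! 0 div 2 ^ (xs ! 1))" by simp
  from total_rec_compose1[OF odd1 this] have "decidable_rel b 2 (\<lambda>g xs. bit (xs ! 0) (xs ! 1))"
    by (simp add: bit_iff_odd)
  from total_rec_compose2[OF this assms] show ?thesis by simp
qed

text \<open>A predicate of finitely many bits is a finite table: splitting on the last bit and
  fixing its value leaves a predicate of fewer bits. No effectivity of \<open>P\<close> enters, so a
  clopen set found noneffectively may still be tested by a program.\<close>

lemma decidable_rel_finite_use:
  assumes "\<And>\<omega> \<omega>'. (\<And>i. i < l \<Longrightarrow> \<omega> i = \<omega>' i) \<Longrightarrow> P \<omega> = P \<omega>'" and "total_rec b n A"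
  shows "decidable_rel b n (\<lambda>g xs. P (bit (A g xs)))"
  using assms(1)
proof (induction l arbitrary: P)
  case 0
  have eq: "P \<omega> = P (\<lambda>_. False)" for \<omega> by (rule 0) auto
  show ?case
    by (rule total_rec_cong[OF total_rec_const[of b n "of_bool (P (\<lambda>_. False))"]])
      (rule arg_cong[OF eq])
next
  case (Suc l)
  have IH: "decidable_rel b n (\<lambda>g xs. P ((bit (A g xs))(l := c)))" for c
    by (rule Suc.IH) (auto intro!: Suc.prems)
  have "decidable_rel b n (\<lambda>g xs. bit (A g xs) l \<and> P ((bit (A g xs))(l := True))
      \<or> \<not> bit (A g xs) l \<and> P ((bit (A g xs))(l := False)))"
    by (intro decidable_rel_disj decidable_rel_conj decidable_rel_not decidable_rel_bit IH
        assms(2) total_rec_const)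
  moreover have eq: "P z \<longleftrightarrow> z l \<and> P (z(l := True)) \<or> \<not> z l \<and> P (z(l := False))" for z
    using fun_upd_triv[of z l] by (cases "z l") auto
  ultimately show ?case by (elim total_rec_cong) (rule arg_cong[OF eq])
qed

section \<open>Evaluation with a bound\<close>

text \<open>
  The value \<open>0\<close> stands for divergence, \<open>Suc y\<close> for output \<open>y\<close>.  The bound \<open>s\<close> limits both the range
  of minimisations and the queries, so that \<open>eval_bound h s\<close> only depends on \<open>h\<close> below \<open>s\<close>.  In the
  case \<open>PMu\<close> at most one summand is nonzero.
\<close>

fun eval_bound :: "(nat \<Rightarrow> nat) \<Rightarrow> nat \<Rightarrow> prog \<Rightarrow> nat list \<Rightarrow> nat" where
  "eval_bound h s PZero xs = 1"
| "eval_bound h s PSucc xs = (if length xs = 1 then Suc (Suc (xs ! 0)) else 0)"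
| "eval_bound h s (PProj i) xs = (if i < length xs then Suc (xs ! i) else 0)"
| "eval_bound h s PQuery xs = (if length xs = 1 \<and> xs ! 0 < s then Suc (h (xs ! 0)) else 0)"
| "eval_bound h s (PComp p qs) xs =
     (if \<forall>q\<in>set qs. eval_bound h s q xs \<noteq> 0
      then eval_bound h s p (map (\<lambda>q. eval_bound h s q xs - 1) qs) else 0)"
| "eval_bound h s (PRec p q) xs =
     (if xs = [] then 0
      else rec_nat (eval_bound h s p (tl xs))
        (\<lambda>i r. if r = 0 then 0 else eval_bound h s q (i # (r - 1) # tl xs)) (hd xs))"
| "eval_bound h s (PMu p) xs =
     (\<Sum>n<s. if eval_bound h s p (n # xs) = 1 \<and> (\<forall>i<n. 2 \<le> eval_bound h s p (i # xs))
             then Suc n else 0)"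

lemma eval_bound_PRec_Suc:
  "eval_bound h s (PRec p q) (Suc n # xs) =
    (if eval_bound h s (PRec p q) (n # xs) = 0 then 0
     else eval_bound h s q (n # (eval_bound h s (PRec p q) (n # xs) - 1) # xs))"
  by (simp cong: if_cong)

text \<open>In the shifted encoding 1 is output zero and a value of at least 2 is a positive output,
  so this is uniqueness of the result of a minimisation.\<close>

lemma first_one_unique:
  fixes f :: "nat \<Rightarrow> nat"
  assumes "f k = 1" "\<forall>i<k. 2 \<le> f i" "f n = 1" "\<forall>i<n. 2 \<le> f i"
  shows "k = n"
  by (rule linorder_cases[of k n]) (use assms in force)+

lemma eval_bound_sound: "eval_bound h s p xs = Suc y \<Longrightarrow> runs h p xs y"
proof (induction p arbitrary: xs y)
  case PZero
  then show ?case by (auto intro: runs.zero)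
next
  case PSucc
  then show ?case by (auto simp: length_Suc_conv split: if_splits intro: runs.succ)
next
  case (PProj i)
  then show ?case by (auto split: if_splits intro: runs.proj)
next
  case PQuery
  then show ?case by (auto simp: length_Suc_conv split: if_splits intro: runs.query)
next
  case (PComp p qs)
  let ?ys = "map (\<lambda>q. eval_bound h s q xs - 1) qs"
  from PComp.prems have nz: "\<forall>q\<in>set qs. eval_bound h s q xs \<noteq> 0"
    and y: "eval_bound h s p ?ys = Suc y" by (auto split: if_splits)
  have "runs h q xs (eval_bound h s q xs - 1)" if "q \<in> set qs" for q
    by (rule PComp.IH(2)[OF that]) (use nz that in auto)
  then have "list_all2 (\<lambda>q y. runs h q xs y) qs ?ys"
    by (auto simp: list_all2_conv_all_nth)
  then show ?case by (rule runs.comp) (rule PComp.IH(1)[OF y])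
next
  case (PRec p q)
  from PRec.prems obtain n zs where xs: "xs = n # zs" by (cases xs) auto
  have "runs h (PRec p q) (n # zs) y" if "eval_bound h s (PRec p q) (n # zs) = Suc y" for n y
    using that
  proof (induction n arbitrary: y)
    case 0
    then show ?case by (auto intro!: runs.rec_0 PRec.IH(1))
  next
    case (Suc n)
    let ?r = "eval_bound h s (PRec p q) (n # zs)"
    from Suc.prems have "?r \<noteq> 0" "eval_bound h s q (n # (?r - 1) # zs) = Suc y"
      unfolding eval_bound_PRec_Suc by (auto split: if_splits)
    then show ?case
      by (intro runs.rec_Suc[where r = "?r - 1"] Suc.IH PRec.IH(2)) auto
  qed
  then show ?case using PRec.prems unfolding xs .
next
  case (PMu p)
  let ?P = "\<lambda>n. eval_bound h s p (n # xs) = 1 \<and> (\<forall>i<n. 2 \<le> eval_bound h s p (i # xs))"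
  have sum: "(\<Sum>n<s. if ?P n then Suc n else 0) = Suc y" using PMu.prems by simp
  have "\<exists>n<s. ?P n"
  proof (rule ccontr)
    assume "\<not> (\<exists>n<s. ?P n)"
    then have "(\<Sum>n<s. if ?P n then Suc n else 0) = 0" by (intro sum.neutral) auto
    with sum show False by simp
  qed
  then obtain n where n: "n < s" "?P n" by blast
  have uniq: "k = n" if "?P k" for k
    by (rule first_one_unique[of "\<lambda>i. eval_bound h s p (i # xs)"]) (use that n(2) in auto)
  have "(\<Sum>n<s. if ?P n then Suc n else 0) = (\<Sum>k<s. if k = n then Suc n else 0)"
  proof (rule sum.cong[OF refl])
    fix k show "(if ?P k then Suc k else 0) = (if k = n then Suc n else 0)"
      using uniq[of k] n(2) by (cases "k = n") auto
  qed
  also have "\<dots> = Suc n" using n(1) by simp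
  finally have "y = n" using sum by simp
  have "runs h (PMu p) xs n"
  proof (rule runs.mu)
    show "runs h p (n # xs) 0" by (rule PMu.IH) (use n(2) in simp)
    show "\<forall>i<n. \<exists>y. runs h p (i # xs) (Suc y)"
    proof (intro allI impI)
      fix i assume "i < n"
      then have "2 \<le> eval_bound h s p (i # xs)" using n(2) by blast
      then have "eval_bound h s p (i # xs) = Suc (Suc (eval_bound h s p (i # xs) - 2))" by simp
      then have "runs h p (i # xs) (Suc (eval_bound h s p (i # xs) - 2))" by (rule PMu.IH)
      then show "\<exists>y. runs h p (i # xs) (Suc y)" by blast
    qed
  qed
  then show ?case using \<open>y = n\<close> by simp
qed

text \<open>A composition or a minimisation has several premises, each reached at its own bound.
  With "eventually" in place of "for some bound", finitely many of them are met at once.\<close>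

lemma eval_bound_complete:
  "runs h p xs y \<Longrightarrow> eventually (\<lambda>s. eval_bound h s p xs = Suc y) sequentially"
proof (induction rule: runs.induct)
  case (zero xs)
  then show ?case by simp
next
  case (succ x)
  then show ?case by simp
next
  case (proj i xs)
  then show ?case by simp
next
  case (query x)
  show ?case using eventually_gt_at_top[of x] by eventually_elim simp
next
  case (comp xs qs ys p z)
  have len: "length qs = length ys" using comp.IH(1) by (rule list_all2_lengthD)
  have "eventually (\<lambda>s. \<forall>i\<in>{..<length ys}. eval_bound h s (qs ! i) xs = Suc (ys ! i)) sequentially"
    using comp.IH(1) by (intro eventually_ball_finite) (auto simp: list_all2_conv_all_nth)
  then show ?case using comp.IH(2)
  proof eventually_elim
    case (elim s)
    have "map (\<lambda>q. eval_bound h s q xs - 1) qs = ys"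
      by (rule nth_equalityI) (use elim(1) len in auto)
    moreover have "\<forall>q\<in>set qs. eval_bound h s q xs \<noteq> 0"
      using elim(1) len by (auto simp: in_set_conv_nth)
    ultimately show ?case using elim(2) by simp
  qed
next
  case (rec_0 p xs y q)
  from rec_0.IH show ?case by eventually_elim simp
next
  case (rec_Suc p q n xs r y)
  from rec_Suc.IH show ?case
    by eventually_elim (simp only: eval_bound_PRec_Suc diff_Suc_1 nat.distinct if_False)
next
  case (mu p n xs)
  have "\<forall>i\<in>{..<n}. eventually (\<lambda>s. 2 \<le> eval_bound h s p (i # xs)) sequentially"
  proof
    fix i assume "i \<in> {..<n}"
    then obtain y where "eventually (\<lambda>s. eval_bound h s p (i # xs) = Suc (Suc y)) sequentially"
      using mu.IH(2) by blast
    then show "eventually (\<lambda>s. 2 \<le> eval_bound h s p (i # xs)) sequentially"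
      by eventually_elim simp
  qed
  then have "eventually (\<lambda>s. \<forall>i\<in>{..<n}. 2 \<le> eval_bound h s p (i # xs)) sequentially"
    by (intro eventually_ball_finite) auto
  then show ?case using mu.IH(1) eventually_gt_at_top[of n]
  proof eventually_elim
    case (elim s)
    have uniq: "k = n" if "eval_bound h s p (k # xs) = 1" "\<forall>i<k. 2 \<le> eval_bound h s p (i # xs)" for k
      by (rule first_one_unique[of "\<lambda>i. eval_bound h s p (i # xs)"]) (use that elim in auto)
    have "eval_bound h s (PMu p) xs = (\<Sum>k<s. if k = n then Suc n else 0)"
      unfolding eval_bound.simps
    proof (rule sum.cong[OF refl])
      fix k
      show "(if eval_bound h s p (k # xs) = 1 \<and> (\<forall>i<k. 2 \<le> eval_bound h s p (i # xs))
          then Suc k else 0) = (if k = n then Suc n else 0)"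
        using uniq[of k] elim by (cases "k = n") auto
    qed
    then show ?case using elim(3) by simp
  qed
qed

text \<open>Queries at \<open>s\<close> or beyond count as divergence, so no further oracle value
  can enter. This makes the event of a given value at bound \<open>s\<close> clopen.\<close>

lemma eval_bound_local:
  "(\<And>x. x < s \<Longrightarrow> h x = h' x) \<Longrightarrow> eval_bound h s p xs = eval_bound h' s p xs"
proof (induction p arbitrary: xs)
  case (PComp p qs)
  have "eval_bound h s q zs = eval_bound h' s q zs" if "q \<in> set qs" for q zs
    using PComp that by blast
  moreover have "eval_bound h s p zs = eval_bound h' s p zs" for zs
    using PComp by blast
  ultimately show ?case by (simp cong: map_cong if_cong)
next
  case (PRec p q)
  have "eval_bound h s p zs = eval_bound h' s p zs" "eval_bound h s q zs = eval_bound h' s q zs" for zs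
    using PRec by blast+
  then show ?case by (simp cong: if_cong)
next
  case (PMu p)
  have "eval_bound h s p zs = eval_bound h' s p zs" for zs
    using PMu by blast
  then show ?case by simp
qed simp_all

lemma runs_iff_eval_bound: "runs h p xs y \<longleftrightarrow> (\<exists>s. eval_bound h s p xs = Suc y)"
  using eval_bound_sound eventually_happens'[OF sequentially_bot eval_bound_complete] by blast

text \<open>The oracle is an argument: \<open>zs ! 0\<close> is its code, which \<open>Q\<close>
  reads, \<open>zs ! 1\<close> is the bound and the rest are the inputs of \<open>p\<close>. With
  \<open>Q\<close> reading bits and \<open>b = False\<close> this evaluates \<open>p\<close> on a
  finite string without queries; with \<open>Q\<close> querying a join it gives decidability
  relative to the join. The arity varies in the induction because subprograms take lists of other
  lengths.\<close>

lemma total_rec_eval_bound: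
  assumes Q: "total_rec b 2 (\<lambda>g ys. Q g (ys ! 0) (ys ! 1))"
  shows "total_rec b (Suc (Suc n)) (\<lambda>g zs. eval_bound (Q g (zs ! 0)) (zs ! 1) p (drop 2 zs))"
proof (induction p arbitrary: n)
  case PZero
  show ?case by (simp add: total_rec_const)
next
  case PSucc
  show ?case
  proof (cases "n = 1")
    case True
    have "total_rec b (Suc (Suc n)) (\<lambda>g zs. Suc (Suc (zs ! 2)))"
      by (intro total_rec_Suc total_rec_proj) (use True in simp)
    then show ?thesis by (rule total_rec_cong) (use True in auto)
  next
    case False
    show ?thesis by (rule total_rec_cong[OF total_rec_const[of _ _ 0]]) (use False in auto)
  qed
next
  case (PProj i)
  show ?case
  proof (cases "i < n")
    case True
    have "total_rec b (Suc (Suc n)) (\<lambda>g zs. Suc (zs ! (i + 2)))"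
      by (intro total_rec_Suc total_rec_proj) (use True in simp)
    then show ?thesis by (rule total_rec_cong) (use True in \<open>auto simp: add.commute\<close>)
  next
    case False
    show ?thesis by (rule total_rec_cong[OF total_rec_const[of _ _ 0]]) (use False in auto)
  qed
next
  case PQuery
  show ?case
  proof (cases "n = 1")
    case True
    have "total_rec b (Suc (Suc n)) (\<lambda>g zs. (\<lambda>g ys. Q g (ys ! 0) (ys ! 1)) g [zs ! 0, zs ! 2])"
      by (intro total_rec_compose2 Q total_rec_proj) (use True in auto)
    then have "total_rec b (Suc (Suc n))
        (\<lambda>g zs. if zs ! 2 < zs ! 1 then Suc (Q g (zs ! 0) (zs ! 2)) else 0)"
      by (intro total_rec_if total_rec_Suc total_rec_proj total_rec_const decidable_rel_less)
        (use True in auto)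
    then show ?thesis by (rule total_rec_cong) (use True in auto)
  next
    case False
    show ?thesis by (rule total_rec_cong[OF total_rec_const[of _ _ 0]]) (use False in auto)
  qed
next
  case (PComp p qs)
  let ?A = "\<lambda>q g zs. eval_bound (Q g (zs ! 0)) (zs ! 1) q (drop 2 zs)"
  \<comment> \<open>Oracle code and bound are passed on unchanged; subtracting 1 turns the encoded
    results of the inner programs into actual arguments.\<close>
  let ?As = "(\<lambda>g zs. zs ! 0) # (\<lambda>g zs. zs ! 1) # map (\<lambda>q g zs. ?A q g zs - 1) qs"
  have "decidable_rel b (Suc (Suc n)) (\<lambda>g zs. \<forall>q\<in>set qs'. ?A q g zs \<noteq> 0)"
    if "set qs' \<subseteq> set qs" for qs'
    using that
  proof (induction qs')
    case Nil
    show ?case using total_rec_const[of _ _ 1] by simp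
  next
    case (Cons q qs')
    then have "decidable_rel b (Suc (Suc n)) (\<lambda>g zs. ?A q g zs \<noteq> 0 \<and> (\<forall>q\<in>set qs'. ?A q g zs \<noteq> 0))"
      by (intro decidable_rel_conj decidable_rel_not decidable_rel_eq total_rec_const PComp.IH(2)) auto
    then show ?case by simp
  qed
  moreover have "total_rec b (Suc (Suc n)) (\<lambda>g zs. ?A p g (map (\<lambda>A. A g zs) ?As))"
    by (rule total_rec_compose)
      (use PComp.IH in \<open>auto intro!: total_rec_proj total_rec_pred[unfolded One_nat_def]\<close>)
  ultimately have "total_rec b (Suc (Suc n)) (\<lambda>g zs. if \<forall>q\<in>set qs. ?A q g zs \<noteq> 0
      then ?A p g (map (\<lambda>A. A g zs) ?As) else 0)"
    by (intro total_rec_if total_rec_const) auto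
  then show ?case by (rule total_rec_cong) (auto simp: comp_def)
next
  case (PRec p q)
  let ?A = "\<lambda>q g zs. eval_bound (Q g (zs ! 0)) (zs ! 1) q (drop 2 zs)"
  show ?case
  proof (cases n)
    case 0
    then show ?thesis by (intro total_rec_cong[OF total_rec_const[of _ _ 0]]) auto
  next
    case (Suc m)
    have 1: "total_rec b (Suc (Suc n)) (\<lambda>g zs. ?A p g (map ((!) zs) (0 # 1 # [3..<Suc (Suc n)])))"
      by (rule total_rec_reindex[OF PRec.IH(1)[of m]]) (use Suc in auto)
    \<comment> \<open>The step sees \<open>i # r # u # s # k # rest\<close>: code and bound are at
      positions 2 and 3, counter and encoded previous value at 0 and 1, and starting from 5 skips
      the recursion argument \<open>k\<close>.\<close>
    let ?As = "(\<lambda>g zs. zs ! 2) # (\<lambda>g zs. zs ! 3) # (\<lambda>g zs. zs ! 0) # (\<lambda>g zs. zs ! 1 - 1)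
      # map (\<lambda>j g zs. zs ! j) [5..<Suc (Suc (Suc (Suc n)))]"
    let ?H = "\<lambda>g zs. if zs ! 1 = 0 then 0 else ?A q g (map (\<lambda>A. A g zs) ?As)"
    have 2: "total_rec b (Suc (Suc (Suc (Suc n)))) ?H"
    proof (intro total_rec_if total_rec_const decidable_rel_eq total_rec_proj total_rec_compose)
      show "total_rec b (length ?As) (?A q)"
        using PRec.IH(2)[of "Suc (Suc m)"] Suc by (simp del: upt_Suc)
    qed (use Suc in \<open>auto intro!: total_rec_proj total_rec_pred[unfolded One_nat_def] simp del: upt_Suc\<close>)
    have "total_rec b (Suc (Suc n)) (\<lambda>g zs. rec_nat (?A p g (map ((!) zs) (0 # 1 # [3..<Suc (Suc n)])))
      (\<lambda>i r. ?H g (i # r # zs)) (zs ! 2))"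
      by (intro total_rec_prim_rec 1 2 total_rec_proj) (use Suc in auto)
    then show ?thesis
    proof (rule total_rec_cong)
      fix g :: "nat \<Rightarrow> nat" and zs :: "nat list"
      assume "length zs = Suc (Suc n)"
      then obtain u s k rest where zs: "zs = u # s # k # rest" "length rest = m"
        using Suc by (auto simp: length_Suc_conv)
      have a: "map ((!) zs) [3..<Suc (Suc n)] = rest"
        by (rule nth_equalityI) (use zs Suc in \<open>auto simp del: upt_Suc\<close>)
      have b: "map (\<lambda>j. (i # r # zs) ! j) [5..<Suc (Suc (Suc (Suc n)))] = rest" for i r
        by (rule nth_equalityI) (use zs Suc in \<open>auto simp del: upt_Suc\<close>)
      show "?A (PRec p q) g zs = rec_nat (?A p g (map ((!) zs) (0 # 1 # [3..<Suc (Suc n)])))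
        (\<lambda>i r. ?H g (i # r # zs)) (zs ! 2)"
        using a b by (simp add: comp_def zs(1) del: upt_Suc cong: if_cong)
    qed
  qed
next
  case (PMu p)
  let ?A = "\<lambda>q g zs. eval_bound (Q g (zs ! 0)) (zs ! 1) q (drop 2 zs)"
  \<comment> \<open>Inside the sum the list is \<open>k # u # s # rest\<close>, under the bounded
    quantifier \<open>i # k # u # s # rest\<close>; the two index lists restore the order code,
    bound, candidate, inputs.\<close>
  have 1: "total_rec b (Suc (Suc (Suc n))) (\<lambda>g zs. ?A p g (map ((!) zs) (1 # 2 # 0 # [3..<Suc (Suc (Suc n))])))"
    by (rule total_rec_reindex[OF PMu.IH[of "Suc n"]]) auto
  have 2: "total_rec b (Suc (Suc (Suc (Suc n)))) (\<lambda>g zs. ?A p g (map ((!) zs) (2 # 3 # 0 # [4..<Suc (Suc (Suc (Suc n)))])))"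
    by (rule total_rec_reindex[OF PMu.IH[of "Suc n"]]) auto
  have "total_rec b (Suc (Suc n)) (\<lambda>g zs. \<Sum>k<zs ! 1. (\<lambda>g zs.
      if ?A p g (map ((!) zs) (1 # 2 # 0 # [3..<Suc (Suc (Suc n))])) = 1 \<and>
         (\<forall>i<zs ! 0. (\<lambda>g zs. 2 \<le> ?A p g (map ((!) zs) (2 # 3 # 0 # [4..<Suc (Suc (Suc (Suc n)))]))) g (i # zs))
      then Suc (zs ! 0) else 0) g (k # zs))"
    by (intro total_rec_sum total_rec_if decidable_rel_conj decidable_rel_eq 1 decidable_rel_ball
        decidable_rel_le 2 total_rec_const total_rec_proj total_rec_Suc) auto
  then show ?case
  proof (rule total_rec_cong)
    fix g :: "nat \<Rightarrow> nat" and zs :: "nat list"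
    assume "length zs = Suc (Suc n)"
    then obtain u s rest where zs: "zs = u # s # rest" "length rest = n"
      by (auto simp: length_Suc_conv)
    have a: "map ((!) (k # zs)) [3..<Suc (Suc (Suc n))] = rest" for k
      by (rule nth_equalityI) (use zs in \<open>auto simp del: upt_Suc\<close>)
    have b: "map ((!) (i # k # zs)) [4..<Suc (Suc (Suc (Suc n)))] = rest" for i k
      by (rule nth_equalityI) (use zs in \<open>auto simp del: upt_Suc\<close>)
    show "?A (PMu p) g zs = (\<Sum>k<zs ! 1. (\<lambda>g zs.
      if ?A p g (map ((!) zs) (1 # 2 # 0 # [3..<Suc (Suc (Suc n))])) = 1 \<and>
         (\<forall>i<zs ! 0. (\<lambda>g zs. 2 \<le> ?A p g (map ((!) zs) (2 # 3 # 0 # [4..<Suc (Suc (Suc (Suc n)))]))) g (i # zs))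
      then Suc (zs ! 0) else 0) g (k # zs))"
      using a b by (simp add: zs(1) del: upt_Suc cong: if_cong)
  qed
qed

section \<open>Clopen sets in the coin-tossing space\<close>

abbreviation coin_space :: "(nat \<Rightarrow> bool) measure" where
  "coin_space \<equiv> \<Pi>\<^sub>M n\<in>UNIV. measure_pmf (bernoulli_pmf (1/2))"

interpretation coin: product_prob_space "\<lambda>_::nat. measure_pmf (bernoulli_pmf (1/2))" UNIV
  by unfold_locales

text \<open>As \<open>s\<close> varies, these are the clopen subsets of Cantor space. The explicit
  \<open>s\<close> allows their measure to be found by counting strings of length
  \<open>s\<close>.\<close>

definition depends_below :: "nat \<Rightarrow> (nat \<Rightarrow> bool) set \<Rightarrow> bool" where
  "depends_below s B \<longleftrightarrow> (\<forall>\<omega> \<omega>'. (\<forall>i<s. \<omega> i = \<omega>' i) \<longrightarrow> (\<omega> \<in> B \<longleftrightarrow> \<omega>' \<in> B))"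

lemma depends_below_mono: "depends_below s B \<Longrightarrow> s \<le> t \<Longrightarrow> depends_below t B"
  unfolding depends_below_def using less_le_trans[of _ s t] by simp

lemma depends_below_Compl: "depends_below s B \<Longrightarrow> depends_below s (UNIV - B)"
  unfolding depends_below_def by blast

lemma depends_below_Un: "depends_below s A \<Longrightarrow> depends_below s B \<Longrightarrow> depends_below s (A \<union> B)"
  unfolding depends_below_def by blast

lemma depends_below_Int: "depends_below s A \<Longrightarrow> depends_below s B \<Longrightarrow> depends_below s (A \<inter> B)"
  unfolding depends_below_def by blast

lemma space_coin: "space coin_space = UNIV"
  by (simp add: space_PiM)

lemma
  shows sets_coin_cylinder: "{\<omega>. \<forall>i<s. \<omega> i = a i} \<in> sets coin_space"
    and measure_coin_cylinder: "measure coin_space {\<omega>. \<forall>i<s. \<omega> i = a i} = 1 / 2 ^ s"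
proof -
  have eq: "{\<omega>. \<forall>i<s. \<omega> i = a i} = coin.emb UNIV {..<s} (\<Pi>\<^sub>E i\<in>{..<s}. {a i})"
    by (auto simp: prod_emb_def restrict_def PiE_iff extensional_def)
  show "{\<omega>. \<forall>i<s. \<omega> i = a i} \<in> sets coin_space" 
    unfolding eq by (intro measurable_prod_emb sets_PiM_I_finite) auto
  have half: "measure (measure_pmf (bernoulli_pmf (1/2))) {c} = 1 / 2" for c
    by (cases c) (simp_all add: measure_pmf_single)
  show "measure coin_space {\<omega>. \<forall>i<s. \<omega> i = a i} = 1 / 2 ^ s"
    unfolding eq by (subst coin.measure_PiM_emb) (simp_all add: half power_divide)
qed

text \<open>Numbers below \<open>2 ^ s\<close> serve as codes of binary strings of length
  \<open>s\<close>; with \<open>nat_bits_unique\<close> the coding is bijective.\<close>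

lemma ex_nat_bits: "\<exists>\<tau><2 ^ s :: nat. \<forall>i<s. bit \<tau> i = (\<omega> i :: bool)"
proof -
  let ?t = "horner_sum of_bool 2 (map \<omega> [0..<s]) :: nat"
  have "?t < 2 ^ s" using horner_sum_of_bool_2_less[of "map \<omega> [0..<s]"] by (simp add: nat_less_iff)
  moreover have "\<forall>i<s. bit ?t i = \<omega> i" by (simp add: bit_horner_sum_bit_iff)
  ultimately show ?thesis by blast
qed

lemma nat_bits_unique:
  fixes \<tau> \<tau>' :: nat
  assumes "\<tau> < 2 ^ s" "\<tau>' < 2 ^ s" "\<And>i. i < s \<Longrightarrow> bit \<tau> i = bit \<tau>' i"
  shows "\<tau> = \<tau>'"
proof -
  have "take_bit s \<tau> = take_bit s \<tau>'" by (rule bit_eqI) (auto simp: bit_take_bit_iff assms(3))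
  then show ?thesis using assms(1,2) by (simp add: take_bit_nat_eq_self)
qed

text \<open>The set is the disjoint union of the cylinders of those strings whose extension by zeros
  lies in it. Comparing measures of clopen sets thereby becomes integer arithmetic.\<close>

lemma
  assumes "depends_below s B"
  shows sets_depends_below: "B \<in> sets coin_space"
    and measure_depends_below: "measure coin_space B = real (card {\<tau>::nat. \<tau> < 2 ^ s \<and> bit \<tau> \<in> B}) / 2 ^ s"
proof -
  let ?T = "{\<tau>::nat. \<tau> < 2 ^ s \<and> bit \<tau> \<in> B}"
  let ?c = "\<lambda>\<tau>::nat. {\<omega>. \<forall>i<s. \<omega> i = bit \<tau> i}"
  have eq: "B = (\<Union>\<tau>\<in>?T. ?c \<tau>)"
  proof (intro set_eqI iffI)
    fix \<omega> assume "\<omega> \<in> B"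
    obtain \<tau> :: nat where \<tau>: "\<tau> < 2 ^ s" "\<forall>i<s. bit \<tau> i = \<omega> i" using ex_nat_bits by blast
    with \<open>\<omega> \<in> B\<close> have "bit \<tau> \<in> B" using assms unfolding depends_below_def by blast
    with \<tau> show "\<omega> \<in> (\<Union>\<tau>\<in>?T. ?c \<tau>)" by auto
  next
    fix \<omega> assume "\<omega> \<in> (\<Union>\<tau>\<in>?T. ?c \<tau>)"
    then show "\<omega> \<in> B" using assms unfolding depends_below_def by blast
  qed
  have fin: "finite ?T" by simp
  show "B \<in> sets coin_space"
    by (subst eq) (intro sets.finite_UN fin sets_coin_cylinder)
  have "disjoint_family_on ?c ?T"
    by (auto simp: disjoint_family_on_def intro: nat_bits_unique)
  then have "measure coin_space (\<Union>\<tau>\<in>?T. ?c \<tau>) = (\<Sum>\<tau>\<in>?T. measure coin_space (?c \<tau>))"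
    using sets_coin_cylinder fin by (intro coin.finite_measure_finite_Union) auto
  then show "measure coin_space B = real (card ?T) / 2 ^ s"
    unfolding eq[symmetric] measure_coin_cylinder by simp
qed

definition clopen_approximable :: "(nat \<Rightarrow> bool) set \<Rightarrow> bool" where
  "clopen_approximable A \<longleftrightarrow>
     (\<forall>e>0. \<exists>l K. depends_below l K \<and> measure coin_space ((A - K) \<union> (K - A)) < e)"

lemma clopen_approximable_Un:
  assumes "clopen_approximable A" "clopen_approximable B"
    and [measurable]: "A \<in> sets coin_space" "B \<in> sets coin_space"
  shows "clopen_approximable (A \<union> B)"
  unfolding clopen_approximable_def
proof (intro allI impI)
  fix e :: real assume "e > 0"
  then obtain l K l' K' where K: "depends_below l K" "measure coin_space ((A - K) \<union> (K - A)) < e / 2"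
    and K': "depends_below l' K'" "measure coin_space ((B - K') \<union> (K' - B)) < e / 2"
    using assms(1,2)[unfolded clopen_approximable_def, rule_format, of "e / 2"] by auto
  note [measurable] = sets_depends_below[OF K(1)] sets_depends_below[OF K'(1)]
  have "measure coin_space ((A \<union> B - (K \<union> K')) \<union> (K \<union> K' - (A \<union> B)))
      \<le> measure coin_space (((A - K) \<union> (K - A)) \<union> ((B - K') \<union> (K' - B)))"
    by (intro coin.finite_measure_mono) auto
  also have "\<dots> \<le> measure coin_space ((A - K) \<union> (K - A)) + measure coin_space ((B - K') \<union> (K' - B))"
    by (intro measure_Un_le) auto
  also have "\<dots> < e" using K(2) K'(2) by simp
  finally show "\<exists>l K. depends_below l K \<and>
      measure coin_space ((A \<union> B - K) \<union> (K - (A \<union> B))) < e"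
    using depends_below_Un[OF depends_below_mono[OF K(1), of "max l l'"]
      depends_below_mono[OF K'(1), of "max l l'"]] by auto
qed

text \<open>The approximable sets contain the generators, which are themselves clopen, and are
  closed under complement and countable union; hence they exhaust the product
  \<sigma>-algebra.\<close>

lemma clopen_approximable_sets:
  assumes "A \<in> sets coin_space"
  shows "clopen_approximable A"
proof -
  have self: "clopen_approximable B" if "depends_below l B" for l B
    unfolding clopen_approximable_def
    by (intro allI impI exI[of _ l] exI[of _ B] conjI that) simp
  let ?G = "{{f \<in> \<Pi>\<^sub>E i\<in>UNIV. space (measure_pmf (bernoulli_pmf (1/2))). f i \<in> A} |
    (i::nat) A. i \<in> UNIV \<and> A \<in> sets (measure_pmf (bernoulli_pmf (1/2)))}"
  have "A \<in> sigma_sets UNIV ?G" using assms unfolding sets_PiM_single by simp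
  then show ?thesis
  proof (induction rule: sigma_sets.induct)
    case (Basic a)
    then obtain i A where a: "a = {f. f i \<in> A}" by auto
    show ?case by (rule self[of "Suc i"]) (auto simp: depends_below_def a)
  next
    case Empty
    show ?case by (rule self[of 0]) (simp add: depends_below_def)
  next
    case (Compl a)
    show ?case unfolding clopen_approximable_def
    proof (intro allI impI)
      fix e :: real assume "e > 0"
      then obtain l K where K: "depends_below l K" "measure coin_space ((a - K) \<union> (K - a)) < e"
        using Compl.IH unfolding clopen_approximable_def by blast
      have "((UNIV - a) - (UNIV - K)) \<union> ((UNIV - K) - (UNIV - a)) = (a - K) \<union> (K - a)" by auto
      with K show "\<exists>l K. depends_below l K \<and>
          measure coin_space ((UNIV - a - K) \<union> (K - (UNIV - a))) < e"
        by (intro exI[of _ l] exI[of _ "UNIV - K"] conjI depends_below_Compl) auto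
    qed
  next
    case (Union a)
    have a[measurable]: "a i \<in> sets coin_space" for i
      using Union.hyps[of i] unfolding sets_PiM_single by simp
    let ?B = "\<lambda>n. \<Union>i<n. a i"
    have fin: "clopen_approximable (?B n)" for n
    proof (induction n)
      case 0
      show ?case by (rule self[of 0]) (simp add: depends_below_def)
    next
      case (Suc n)
      have "clopen_approximable (?B n \<union> a n)"
        by (rule clopen_approximable_Un[OF Suc Union.IH]) auto
      then show ?case by (simp add: lessThan_Suc Un_commute)
    qed
    show ?case unfolding clopen_approximable_def
    proof (intro allI impI)
      fix e :: real assume "e > 0"
      \<comment> \<open>Half of \<open>e\<close> pays for cutting the union down to a finite one,
        the other half for approximating that finite union.\<close>
      have "(\<lambda>n. measure coin_space (?B n)) \<longlonglongrightarrow> measure coin_space (\<Union>n. ?B n)"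
        by (intro coin.finite_Lim_measure_incseq) (force simp: incseq_def)+
      moreover have "(\<Union>n. ?B n) = (\<Union>i. a i)" by auto
      ultimately have "eventually (\<lambda>n. measure coin_space (\<Union>i. a i) - e / 2 < measure coin_space (?B n)) sequentially"
        using \<open>e > 0\<close> by (intro order_tendstoD(1)[where y = "measure coin_space (\<Union>i. a i)"]) auto
      then obtain n where n: "measure coin_space (\<Union>i. a i) - e / 2 < measure coin_space (?B n)"
        using eventually_happens'[OF sequentially_bot] by blast
      have n': "measure coin_space ((\<Union>i. a i) - ?B n) < e / 2"
        using n by (subst coin.finite_measure_Diff) auto
      obtain l K where K: "depends_below l K" "measure coin_space ((?B n - K) \<union> (K - ?B n)) < e / 2"
        using fin[of n, unfolded clopen_approximable_def, rule_format, of "e / 2"] \<open>e > 0\<close> by auto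
      note [measurable] = sets_depends_below[OF K(1)]
      have "measure coin_space (((\<Union>i. a i) - K) \<union> (K - (\<Union>i. a i)))
          \<le> measure coin_space (((\<Union>i. a i) - ?B n) \<union> ((?B n - K) \<union> (K - ?B n)))"
        by (intro coin.finite_measure_mono) auto
      also have "\<dots> \<le> measure coin_space ((\<Union>i. a i) - ?B n) + measure coin_space ((?B n - K) \<union> (K - ?B n))"
        by (intro measure_Un_le) auto
      also have "\<dots> < e" using n' K(2) by simp
      finally show "\<exists>l K. depends_below l K \<and> measure coin_space (((\<Union>i. a i) - K) \<union> (K - (\<Union>i. a i))) < e"
        using K(1) by blast
    qed
  qed
qed

text \<open>A clopen set close enough to \<open>C\<close> in measure consists mostly of points of
  \<open>C\<close>. This does the work of the Lebesgue density theorem.\<close>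

lemma clopen_concentration:
  assumes C: "C \<in> sets coin_space" and pos: "measure coin_space C > 0"
  shows "\<exists>l K. depends_below l K \<and> measure coin_space K > 0 \<and>
    measure coin_space (K - C) < measure coin_space K / 8"
proof -
  note [measurable] = C
  \<comment> \<open>With an error below 1/9 of \<open>C\<close>, the measure of \<open>K\<close>
    exceeds 8/9 of that of \<open>C\<close>, so the error is below 1/8 of \<open>K\<close>.\<close>
  have "0 < measure coin_space C / 9" using pos by simp
  then obtain l K where K: "depends_below l K"
    "measure coin_space ((C - K) \<union> (K - C)) < measure coin_space C / 9"
    using clopen_approximable_sets[OF C] unfolding clopen_approximable_def by blast
  note [measurable] = sets_depends_below[OF K(1)]
  have "measure coin_space C \<le> measure coin_space (K \<union> ((C - K) \<union> (K - C)))"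
    by (intro coin.finite_measure_mono) auto
  also have "\<dots> \<le> measure coin_space K + measure coin_space ((C - K) \<union> (K - C))"
    by (intro measure_Un_le) auto
  finally have "measure coin_space C * (8 / 9) < measure coin_space K" using K(2) by simp
  moreover have "measure coin_space (K - C) \<le> measure coin_space ((C - K) \<union> (K - C))"
    by (intro coin.finite_measure_mono) auto
  ultimately have "measure coin_space K > 0" "measure coin_space (K - C) < measure coin_space K / 8"
    using K(2) pos by linarith+
  with K(1) show ?thesis by blast
qed

lemma null_sets_cantor:
  assumes "Collect -` C \<in> null_sets coin_space"
  shows "C \<in> null_sets cantor_measure"
proof -
  have inj: "inj (Collect :: (nat \<Rightarrow> bool) \<Rightarrow> nat set)" by (auto simp: inj_def)
  have "surj (Collect :: (nat \<Rightarrow> bool) \<Rightarrow> nat set)"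
    by (rule surjI[of _ "\<lambda>X n. n \<in> X"]) simp
  then have "Collect ` (Collect -` C) = C" by (rule surj_image_vimage_eq)
  then have sets: "C \<in> sets (embed_measure coin_space Collect)"
    using in_sets_embed_measure[of "Collect -` C" coin_space Collect] assms by (auto dest: null_setsD2)
  have "emeasure (embed_measure coin_space Collect) C = 0"
    using emeasure_embed_measure[OF inj sets] assms by (simp add: space_coin null_setsD1)
  with sets show ?thesis
    unfolding cantor_measure_def by (intro null_sets_completionI) auto
qed

lemma null_sets_cantor_subset:
  "A \<subseteq> B \<Longrightarrow> B \<in> null_sets cantor_measure \<Longrightarrow> A \<in> null_sets cantor_measure"
  unfolding cantor_measure_def by (rule null_sets_completion_subset)

section \<open>Descriptions computed by a program\<close>

lemma total_rec_eval_bound_unary: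
  assumes "total_rec b 2 (\<lambda>g ys. Q g (ys ! 0) (ys ! 1))"
    and "total_rec b n U" "total_rec b n A" "total_rec b n B"
  shows "total_rec b n (\<lambda>g xs. eval_bound (Q g (U g xs)) (A g xs) p [B g xs])"
proof -
  have "total_rec b n (\<lambda>g xs. (\<lambda>g zs. eval_bound (Q g (zs ! 0)) (zs ! 1) p (drop 2 zs)) g
      (map (\<lambda>A. A g xs) [U, A, B]))"
    by (rule total_rec_compose) (use assms total_rec_eval_bound[OF assms(1), of 1] in auto)
  then show ?thesis by simp
qed

text \<open>Searching for the pair of value and stage is reduced to minimising one number: first the
  least stage with a success below it, then a value at that stage. The restriction
  \<open>v < s\<close> keeps each stage a bounded search.\<close>

lemma total_rec_search:
  assumes R: "decidable_rel b 3 (\<lambda>g ys. R (ys ! 0) (ys ! 1) (ys ! 2))"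
    and ex: "\<And>n. \<exists>s. \<exists>v<s. R v s n"
  shows "\<exists>V. total_rec b 1 (\<lambda>g xs. V (xs ! 0)) \<and> (\<forall>n. \<exists>s. R (V n) s n)"
proof -
  define S where "S n = (LEAST s. \<exists>v<s. R v s n)" for n
  \<comment> \<open>The clause \<open>v < s\<close> stops the second search at \<open>s\<close> at
    the latest, so \<open>L\<close> is total even at stages without success.\<close>
  define L where "L s n = (LEAST v. \<not> (v < s \<and> \<not> R v s n))" for s n
  have S: "\<exists>v<S n. R v (S n) n" for n unfolding S_def by (rule LeastI_ex) (rule ex)
  have R': "decidable_rel b (Suc 2) (\<lambda>g ys. R (ys ! 0) (ys ! 1) (ys ! 2))"
    using R by (simp add: eval_nat_numeral)
  have "decidable_rel b 2 (\<lambda>g ys. \<exists>v<ys ! 0. (\<lambda>g ys. R (ys ! 0) (ys ! 1) (ys ! 2)) g (v # ys))"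
    by (intro decidable_rel_bex R' total_rec_proj) auto
  from decidable_rel_not[OF this]
  have "total_rec b 1 (\<lambda>g xs. LEAST s. (\<lambda>g ys. of_bool (\<not> (\<exists>v<ys ! 0. R v (ys ! 0) (ys ! 1)))) g (s # xs) = (0::nat))"
    by (intro total_rec_mu) (use ex in \<open>auto simp: eval_nat_numeral length_Suc_conv\<close>)
  then have tS: "total_rec b 1 (\<lambda>g xs. S (xs ! 0))" by (simp add: S_def)
  have "decidable_rel b (Suc 2) (\<lambda>g ys. ys ! 0 < ys ! 1 \<and> \<not> R (ys ! 0) (ys ! 1) (ys ! 2))"
    by (intro decidable_rel_conj decidable_rel_less decidable_rel_not R' total_rec_proj) auto
  then have "total_rec b 2 (\<lambda>g xs. LEAST v. (\<lambda>g ys. of_bool (ys ! 0 < ys ! 1 \<and> \<not> R (ys ! 0) (ys ! 1) (ys ! 2))) g (v # xs) = (0::nat))"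
    by (rule total_rec_mu) (auto intro: less_irrefl)
  then have tL: "total_rec b 2 (\<lambda>g xs. L (xs ! 0) (xs ! 1))" by (simp add: L_def)
  have "total_rec b 1 (\<lambda>g xs. L (S (xs ! 0)) (xs ! 0))"
    using total_rec_compose2[OF tL tS total_rec_proj[of 0 1]] by simp
  moreover have "R (L (S n) n) (S n) n" for n
  proof -
    obtain v where v: "v < S n" "R v (S n) n" using S by blast
    have "L (S n) n \<le> v" unfolding L_def by (rule Least_le) (use v in auto)
    moreover have "\<not> (L (S n) n < S n \<and> \<not> R (L (S n) n) (S n) n)"
      unfolding L_def by (rule LeastI[of _ v]) (use v in auto)
    ultimately show ?thesis using v(1) by auto
  qed
  ultimately show ?thesis by (intro exI[of _ "\<lambda>n. L (S n) n"]) auto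
qed

lemma computable_total_rec: "total_rec False 1 (\<lambda>g xs. V (xs ! 0)) \<Longrightarrow> computable V"
  unfolding total_rec_def computable_def computes_def by (metis One_nat_def length_Cons list.size(3) nth_Cons_0)

section \<open>Composition of relative computations\<close>

fun subst_query :: "prog \<Rightarrow> prog \<Rightarrow> prog" where
  "subst_query r PZero = PZero"
| "subst_query r PSucc = PSucc"
| "subst_query r (PProj i) = PProj i"
| "subst_query r PQuery = r"
| "subst_query r (PComp p qs) = PComp (subst_query r p) (map (subst_query r) qs)"
| "subst_query r (PRec p q) = PRec (subst_query r p) (subst_query r q)"
| "subst_query r (PMu p) = PMu (subst_query r p)"

text \<open>A program computing \<open>h\<close> takes one argument, just as a query does, so it can
  stand in place of every \<open>PQuery\<close> while the rest of the computation is
  unchanged.\<close>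

lemma runs_subst_query:
  assumes "runs h p xs y" and r: "computes g r h"
  shows "runs g (subst_query r p) xs y"
  using assms(1)
proof (induction rule: runs.induct)
  case (query x)
  show ?case using r by (simp add: computes_def)
next
  case (comp xs qs ys p z)
  have "list_all2 (\<lambda>q y. runs g q xs y) (map (subst_query r) qs) ys"
    using comp.IH(1) by (simp add: list_all2_conv_all_nth)
  then show ?case using comp.IH(2) by (auto intro: runs.comp)
qed (auto intro: runs.intros)

lemma computable_in_trans:
  assumes "computable_in g h" "computable_in h k"
  shows "computable_in g k"
  using assms runs_subst_query unfolding computable_in_def
  by (metis computes_def)

section \<open>Density as an arithmetical condition\<close>

lemma card_inter_lessThan:
  fixes n :: nat
  shows "card (Z \<inter> {..<n}) = (\<Sum>m<n. of_bool (m \<in> Z))"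
  by (induction n) (auto simp: lessThan_Suc Int_insert_right)

text \<open>Here \<open>1 / k\<close> plays the tolerance. Multiplying out gives a condition on
  integers with the prefix for-all, exists, for-all, as a \<Pi>_3 class requires.\<close>

lemma zero_density_iff:
  "(\<lambda>n. real (card (Z \<inter> {..<n})) / real n) \<longlonglongrightarrow> 0 \<longleftrightarrow>
    (\<forall>k. \<exists>a. \<forall>n\<ge>a. k * card (Z \<inter> {..<n}) \<le> n)"
proof
  assume L: "(\<lambda>n. real (card (Z \<inter> {..<n})) / real n) \<longlonglongrightarrow> 0"
  show "\<forall>k. \<exists>a. \<forall>n\<ge>a. k * card (Z \<inter> {..<n}) \<le> n"
  proof
    fix k
    \<comment> \<open>Using \<open>Suc k\<close> keeps the tolerance positive at
      \<open>k = 0\<close>.\<close>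
    have "eventually (\<lambda>n. real (card (Z \<inter> {..<n})) / real n < 1 / real (Suc k)) sequentially"
      using order_tendstoD(2)[OF L, of "1 / real (Suc k)"] by simp
    then have "eventually (\<lambda>n. k * card (Z \<inter> {..<n}) \<le> n) sequentially"
    proof eventually_elim
      case (elim n)
      show ?case
      proof (cases "n = 0")
        case False
        with elim have "real (Suc k) * real (card (Z \<inter> {..<n})) < real n" by (simp add: field_simps)
        then have "Suc k * card (Z \<inter> {..<n}) < n"
          by (simp only: of_nat_mult[symmetric] of_nat_less_iff)
        then show ?thesis by simp
      qed simp
    qed
    then show "\<exists>a. \<forall>n\<ge>a. k * card (Z \<inter> {..<n}) \<le> n" by (simp add: eventually_sequentially)
  qed
next
  assume R: "\<forall>k. \<exists>a. \<forall>n\<ge>a. k * card (Z \<inter> {..<n}) \<le> n"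
  show "(\<lambda>n. real (card (Z \<inter> {..<n})) / real n) \<longlonglongrightarrow> 0"
  proof (rule LIMSEQ_I)
    fix e :: real assume "0 < e"
    then obtain k :: nat where k: "1 / e < real k" using reals_Archimedean2 by blast
    then have "k > 0" using \<open>0 < e\<close> by (metis divide_pos_pos gr0I less_asym of_nat_0 zero_less_one)
    obtain a where a: "\<forall>n\<ge>a. k * card (Z \<inter> {..<n}) \<le> n" using R by blast
    show "\<exists>a. \<forall>n\<ge>a. norm (real (card (Z \<inter> {..<n})) / real n - 0) < e"
    proof (intro exI allI impI)
      \<comment> \<open>The threshold \<open>Suc a\<close> instead of \<open>a\<close> keeps
        \<open>n\<close> positive for the division.\<close>
      fix n assume n: "Suc a \<le> n"
      then have "k * card (Z \<inter> {..<n}) \<le> n" using a by simp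
      then have "real k * real (card (Z \<inter> {..<n})) \<le> real n"
        by (simp only: of_nat_mult[symmetric] of_nat_le_iff)
      then have "real (card (Z \<inter> {..<n})) / real n \<le> 1 / real k"
        using n \<open>k > 0\<close> by (simp add: field_simps)
      also have "\<dots> < e" using k \<open>0 < e\<close> \<open>k > 0\<close> by (simp add: field_simps)
      finally show "norm (real (card (Z \<inter> {..<n})) / real n - 0) < e" by simp
    qed
  qed
qed

lemma has_density_one_iff:
  "has_density {n. n \<notin> Z} 1 \<longleftrightarrow> (\<lambda>n. real (card (Z \<inter> {..<n})) / real n) \<longlonglongrightarrow> 0"
proof -
  \<comment> \<open>At \<open>n = 0\<close> division by zero makes the left side 0 and the right
    side 1, so the two sequences agree only eventually.\<close>
  have eq: "partial_density n {n. n \<notin> Z} = 1 - real (card (Z \<inter> {..<n})) / real n" if "n > 0" for n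
  proof -
    have "{n. n \<notin> Z} \<inter> {0..<n} \<union> Z \<inter> {..<n} = {..<n}" by auto
    then have "card ({n. n \<notin> Z} \<inter> {0..<n}) + card (Z \<inter> {..<n}) = card {..<n}"
      by (subst card_Un_disjoint[symmetric]) auto
    then have "real (card ({n. n \<notin> Z} \<inter> {0..<n})) = real n - real (card (Z \<inter> {..<n}))"
      by simp
    then show ?thesis using that by (simp add: partial_density_def field_simps)
  qed
  have "has_density {n. n \<notin> Z} 1 \<longleftrightarrow> (\<lambda>n. 1 - real (card (Z \<inter> {..<n})) / real n) \<longlonglongrightarrow> 1"
    unfolding has_density_def
    by (rule tendsto_cong) (use eq in \<open>auto simp: eventually_sequentially intro!: exI[of _ 1]\<close>)
  also have "\<dots> \<longleftrightarrow> (\<lambda>n. real (card (Z \<inter> {..<n})) / real n) \<longlonglongrightarrow> 0"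
  proof
    assume "(\<lambda>n. 1 - real (card (Z \<inter> {..<n})) / real n) \<longlonglongrightarrow> 1"
    from tendsto_diff[OF tendsto_const[of 1] this]
    show "(\<lambda>n. real (card (Z \<inter> {..<n})) / real n) \<longlonglongrightarrow> 0" by simp
  next
    assume "(\<lambda>n. real (card (Z \<inter> {..<n})) / real n) \<longlonglongrightarrow> 0"
    from tendsto_diff[OF tendsto_const[of 1] this]
    show "(\<lambda>n. 1 - real (card (Z \<inter> {..<n})) / real n) \<longlonglongrightarrow> 1" by simp
  qed
  finally show ?thesis .
qed

text \<open>
  Only the \<open>\<box>\<close>-values found by stage \<open>b\<close> are counted; as \<open>b\<close> is universally quantified, this
  expresses the density condition with a decidable matrix.
\<close>

definition desc_matrix :: "prog \<Rightarrow> (nat \<Rightarrow> nat) \<Rightarrow> nat set \<Rightarrow> nat \<Rightarrow> nat \<Rightarrow> nat \<Rightarrow> bool" where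
  "desc_matrix p f X k a b \<longleftrightarrow>
     (eval_bound (char_fun X) a p [k] = 1 \<or> eval_bound (char_fun X) a p [k] = f k + 2) \<and>
     (\<forall>n<Suc b. a \<le> n \<longrightarrow> k * (\<Sum>m<n. of_bool (eval_bound (char_fun X) b p [m] = 1)) \<le> n)"

text \<open>Two conditions share one prefix: \<open>k\<close> is both an input on which
  \<open>p\<close> must halt and the tolerance \<open>1 / k\<close>, and \<open>a\<close> is both a
  sufficient evaluation bound and the threshold for the density.\<close>

definition desc_class :: "prog \<Rightarrow> (nat \<Rightarrow> nat) \<Rightarrow> nat set set" where
  "desc_class p f = {X. \<forall>k. \<exists>a. \<forall>b. desc_matrix p f X k a b}"

text \<open>By soundness a count at stage \<open>b\<close> never exceeds the true count, and for
  fixed \<open>n\<close> it is exact from some \<open>b\<close> on. So the inequality for all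
  \<open>b\<close> is the inequality for the true count.\<close>

lemma desc_class_iff:
  "X \<in> desc_class p f \<longleftrightarrow>
    (\<forall>m. runs (char_fun X) p [m] 0 \<or> runs (char_fun X) p [m] (Suc (f m))) \<and>
    (\<lambda>n. real (card ({m. runs (char_fun X) p [m] 0} \<inter> {..<n})) / real n) \<longlonglongrightarrow> 0"
    (is "_ \<longleftrightarrow> ?tot \<and> ?dens")
proof -
  let ?E = "\<lambda>s m. eval_bound (char_fun X) s p [m]"
  let ?Z = "{m. runs (char_fun X) p [m] 0}"
  have count: "(\<Sum>m<n. of_bool (?E b m = 1)) \<le> card (?Z \<inter> {..<n})" for n b
    unfolding card_inter_lessThan by (rule sum_mono) (auto intro: eval_bound_sound)
  have count': "eventually (\<lambda>b. (\<Sum>m<n. of_bool (?E b m = 1)) = card (?Z \<inter> {..<n})) sequentially" for n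
  proof -
    have "eventually (\<lambda>b. \<forall>m\<in>?Z \<inter> {..<n}. ?E b m = 1) sequentially"
      using eval_bound_complete[of "char_fun X" p _ 0] by (intro eventually_ball_finite) auto
    then show ?thesis
    proof eventually_elim
      case (elim b)
      have "card (?Z \<inter> {..<n}) \<le> (\<Sum>m<n. of_bool (?E b m = 1))"
        unfolding card_inter_lessThan by (rule sum_mono) (use elim in auto)
      with count[where n = n and b = b] show ?case by simp
    qed
  qed
  show ?thesis
  proof
    assume "X \<in> desc_class p f"
    then obtain a where a: "\<And>k b. desc_matrix p f X k (a k) b"
      unfolding desc_class_def by (auto simp: choice_iff)
    have ?tot
    proof
      fix m
      have "?E (a m) m = Suc 0 \<or> ?E (a m) m = Suc (Suc (f m))"
        using a[of m 0] by (auto simp: desc_matrix_def)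
      then show "runs (char_fun X) p [m] 0 \<or> runs (char_fun X) p [m] (Suc (f m))"
        by (auto dest: eval_bound_sound)
    qed
    moreover have "\<forall>k. \<exists>a. \<forall>n\<ge>a. k * card (?Z \<inter> {..<n}) \<le> n"
    proof (intro allI exI impI)
      fix k n assume n: "a k \<le> n"
      \<comment> \<open>The matrix at \<open>b\<close> inspects only lengths up to \<open>b\<close>,
        hence the extra demand \<open>n \<le> b\<close>.\<close>
      have "eventually (\<lambda>b. (\<Sum>m<n. of_bool (?E b m = 1)) = card (?Z \<inter> {..<n}) \<and> n \<le> b) sequentially"
        using count' eventually_ge_at_top by (rule eventually_conj)
      then obtain b where "(\<Sum>m<n. of_bool (?E b m = 1)) = card (?Z \<inter> {..<n})" "n \<le> b"
        using eventually_happens'[OF sequentially_bot] by blast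
      with a[of k b] n show "k * card (?Z \<inter> {..<n}) \<le> n"
        by (auto simp: desc_matrix_def less_Suc_eq_le)
    qed
    ultimately show "?tot \<and> ?dens" by (simp add: zero_density_iff)
  next
    assume asm: "?tot \<and> ?dens"
    show "X \<in> desc_class p f"
      unfolding desc_class_def mem_Collect_eq
    proof
      fix k
      obtain a where a: "\<forall>n\<ge>a. k * card (?Z \<inter> {..<n}) \<le> n"
        using asm zero_density_iff by blast
      \<comment> \<open>The single witness must show the output on \<open>k\<close> and lie beyond
        the density threshold; both hold for all large \<open>s\<close>.\<close>
      have "eventually (\<lambda>s. (?E s k = 1 \<or> ?E s k = f k + 2) \<and> a \<le> s) sequentially"
      proof (rule eventually_conj[OF _ eventually_ge_at_top])
        have "runs (char_fun X) p [k] 0 \<or> runs (char_fun X) p [k] (Suc (f k))" using asm by blast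
        then show "eventually (\<lambda>s. ?E s k = 1 \<or> ?E s k = f k + 2) sequentially"
          by (auto dest!: eval_bound_complete elim: eventually_mono)
      qed
      then obtain s where s: "?E s k = 1 \<or> ?E s k = f k + 2" "a \<le> s"
        using eventually_happens'[OF sequentially_bot] by blast
      have "k * (\<Sum>m<n. of_bool (?E b m = 1)) \<le> n" if "s \<le> n" for b n
        using mult_le_mono2[OF count[of b n], of k] a that s(2) by (meson le_trans)
      with s(1) show "\<exists>a. \<forall>b. desc_matrix p f X k a b"
        unfolding desc_matrix_def by blast
    qed
  qed
qed

lemma eff_dense_computable_in_desc_class:
  assumes "eff_dense_computable_in X f"
  shows "\<exists>p. X \<in> desc_class p f"
proof -
  obtain d p where d: "eff_dense_desc f d" and p: "computes (char_fun X) p (code_desc d)"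
    using assms unfolding eff_dense_computable_in_def computable_in_def by blast
  have run: "runs (char_fun X) p [m] y \<longleftrightarrow> y = code_desc d m" for m y
    using p runs_deterministic unfolding computes_def by metis
  have "code_desc d m = 0 \<or> code_desc d m = Suc (f m)" for m
  proof (cases "d m")
    case (Some v)
    then have "d m = Some (f m)" using d unfolding eff_dense_desc_def by simp
    then show ?thesis by (simp add: code_desc_def)
  qed (simp add: code_desc_def)
  then have "\<forall>m. runs (char_fun X) p [m] 0 \<or> runs (char_fun X) p [m] (Suc (f m))"
    unfolding run by metis
  moreover have "{n. d n \<noteq> None} = {n. n \<notin> {m. runs (char_fun X) p [m] 0}}"
    unfolding run by (auto simp: code_desc_def split: option.splits)
  then have "has_density {n. n \<notin> {m. runs (char_fun X) p [m] 0}} 1"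
    using d unfolding eff_dense_desc_def by simp
  ultimately have "X \<in> desc_class p f"
    unfolding desc_class_iff has_density_one_iff by blast
  then show ?thesis ..
qed

lemma Pi_class_desc_class: "Pi_class 3 f (desc_class p f)"
proof -
  \<comment> \<open>In the join \<open>X\<close> occupies the even places and \<open>f\<close> the
    odd ones. The list is \<open>[k, a, b]\<close>, inside the quantifier
    \<open>[n, k, a, b]\<close> and inside the sum \<open>[m, n, k, a, b]\<close>, so that
    \<open>b\<close> moves to position 4.\<close>
  define F where "F g ks \<longleftrightarrow>
      (eval_bound (\<lambda>x. g (2 * x)) (ks ! 1) p [ks ! 0] = 1 \<or>
       eval_bound (\<lambda>x. g (2 * x)) (ks ! 1) p [ks ! 0] = g (Suc (2 * (ks ! 0))) + 2) \<and>
      (\<forall>n<Suc (ks ! 2). (\<lambda>g ks. ks ! 2 \<le> ks ! 0 \<longrightarrow>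
        ks ! 1 * (\<Sum>m<ks ! 0. (\<lambda>g ks. of_bool (eval_bound (\<lambda>x. g (2 * x)) (ks ! 4) p [ks ! 0] = 1)) g (m # ks))
          \<le> ks ! 0) g (n # ks))" for g :: "nat \<Rightarrow> nat" and ks :: "nat list"
  have q: "total_rec True 2 (\<lambda>g ys. g (2 * ys ! 1))"
    by (intro total_rec_query total_rec_mult total_rec_const total_rec_proj) auto
  \<comment> \<open>The join is queried directly, so the slot for an oracle code is filled with the
    constant 0.\<close>
  have ev: "total_rec True n (\<lambda>g xs. eval_bound (\<lambda>x. g (2 * x)) (A g xs) p [B g xs])"
    if "total_rec True n A" "total_rec True n B" for n A B
    using total_rec_eval_bound_unary[of True "\<lambda>g u x. g (2 * x)", OF q total_rec_const[of True n 0] that] by simp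
  have "decidable_rel True 3 F"
    unfolding F_def
    by (intro decidable_rel_conj decidable_rel_disj decidable_rel_eq ev decidable_rel_ball decidable_rel_imp
        decidable_rel_le total_rec_query total_rec_add total_rec_mult total_rec_sum total_rec_Suc
        total_rec_const total_rec_proj) auto
  then obtain q where q: "\<And>g xs. length xs = 3 \<Longrightarrow> runs g q xs (of_bool (F g xs))"
    unfolding total_rec_def by blast
  have F: "F (join (char_fun X) f) ks = desc_matrix p f X (ks ! 0) (ks ! 1) (ks ! 2)" for X ks
    by (simp add: F_def desc_matrix_def join_def)
  show ?thesis
    unfolding Pi_class_def
  proof (intro exI conjI allI)
    fix X
    show "decides (join (char_fun X) f) q 3 (\<lambda>ks. desc_matrix p f X (ks ! 0) (ks ! 1) (ks ! 2))"
      unfolding decides_def F[symmetric] using q by blast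
  next
    show "desc_class p f = {X. alternating 3 True (\<lambda>ks. desc_matrix p f X (ks ! 0) (ks ! 1) (ks ! 2))}"
      by (simp add: desc_class_def numeral_3_eq_3 numeral_2_eq_2)
  qed
qed

section \<open>The majority vote\<close>

text \<open>Makes the union of \<open>desc_class p f\<close> over all programs a countable union of
  null sets.\<close>

instance prog :: countable
  by countable_datatype

lemma char_fun_Collect: "char_fun (Collect \<omega>) = (\<lambda>x. of_bool (\<omega> x))"
  by (auto simp: indicator_def)

lemma eval_bound_Collect_local:
  "(\<And>i. i < s \<Longrightarrow> \<omega> i = \<omega>' i) \<Longrightarrow>
    eval_bound (char_fun (Collect \<omega>)) s p xs = eval_bound (char_fun (Collect \<omega>')) s p xs"
  by (rule eval_bound_local) (simp add: char_fun_Collect)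

lemma depends_below_eval_bound:
  "depends_below s {\<omega>. eval_bound (char_fun (Collect \<omega>)) s p xs = y}"
  unfolding depends_below_def
proof (intro allI impI)
  fix \<omega> \<omega>' :: "nat \<Rightarrow> bool"
  assume "\<forall>i<s. \<omega> i = \<omega>' i"
  then have "eval_bound (char_fun (Collect \<omega>)) s p xs = eval_bound (char_fun (Collect \<omega>')) s p xs"
    by (intro eval_bound_Collect_local) simp
  then show "\<omega> \<in> {\<omega>. eval_bound (char_fun (Collect \<omega>)) s p xs = y} \<longleftrightarrow>
      \<omega>' \<in> {\<omega>. eval_bound (char_fun (Collect \<omega>)) s p xs = y}"
    by simp
qed

lemma sets_runs[measurable]: "{\<omega>. runs (char_fun (Collect \<omega>)) p xs y} \<in> sets coin_space"
proof -
  have "{\<omega>. runs (char_fun (Collect \<omega>)) p xs y} =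
      (\<Union>s. {\<omega>. eval_bound (char_fun (Collect \<omega>)) s p xs = Suc y})"
    by (auto simp: runs_iff_eval_bound)
  also have "\<dots> \<in> sets coin_space"
    by (intro sets.countable_UN) (use sets_depends_below[OF depends_below_eval_bound] in auto)
  finally show ?thesis .
qed

lemma sets_desc_class: "Collect -` desc_class p f \<in> sets coin_space"
proof -
  have "{\<omega>. desc_matrix p f (Collect \<omega>) k a b} \<in> sets coin_space" for k a b
  proof (rule sets_depends_below[of "max a b"])
    show "depends_below (max a b) {\<omega>. desc_matrix p f (Collect \<omega>) k a b}"
      unfolding depends_below_def
    proof (intro allI impI)
      fix \<omega> \<omega>' :: "nat \<Rightarrow> bool"
      assume eq: "\<forall>i<max a b. \<omega> i = \<omega>' i"
      have "eval_bound (char_fun (Collect \<omega>)) a p xs = eval_bound (char_fun (Collect \<omega>')) a p xs"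
        "eval_bound (char_fun (Collect \<omega>)) b p xs = eval_bound (char_fun (Collect \<omega>')) b p xs" for xs
        by (rule eval_bound_Collect_local; use eq in simp)+
      then show "\<omega> \<in> {\<omega>. desc_matrix p f (Collect \<omega>) k a b} \<longleftrightarrow>
          \<omega>' \<in> {\<omega>. desc_matrix p f (Collect \<omega>) k a b}"
        by (simp add: desc_matrix_def)
    qed
  qed
  then have "(\<Inter>k. \<Union>a. \<Inter>b. {\<omega>. desc_matrix p f (Collect \<omega>) k a b}) \<in> sets coin_space"
    by (intro sets.countable_INT sets.countable_UN) auto
  moreover have "Collect -` desc_class p f = (\<Inter>k. \<Union>a. \<Inter>b. {\<omega>. desc_matrix p f (Collect \<omega>) k a b})"
    by (auto simp: desc_class_def)
  ultimately show ?thesis by simp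
qed

text \<open>The events "value \<open>y\<close> at every bound from \<open>s\<close> on" increase
  with \<open>s\<close> and exhaust the halting event, so continuity from below applies to them;
  each lies inside the event at the single bound \<open>s\<close>.\<close>

lemma measure_runs_stage:
  assumes K: "depends_below l K"
    and c: "c < measure coin_space (K \<inter> {\<omega>. runs (char_fun (Collect \<omega>)) p xs y})"
  shows "eventually (\<lambda>s. c < measure coin_space
    (K \<inter> {\<omega>. eval_bound (char_fun (Collect \<omega>)) s p xs = Suc y})) sequentially"
proof -
  let ?E = "\<lambda>s. {\<omega>. eval_bound (char_fun (Collect \<omega>)) s p xs = Suc y}"
  let ?B = "\<lambda>s. K \<inter> (\<Inter>t\<in>{s..}. ?E t)"
  have [measurable]: "?E s \<in> sets coin_space" for s
    by (rule sets_depends_below[OF depends_below_eval_bound])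
  note [measurable] = sets_depends_below[OF K]
  have B: "?B s \<in> sets coin_space" for s
    by (intro sets.Int sets.countable_INT') auto
  have "(\<lambda>s. measure coin_space (?B s)) \<longlonglongrightarrow> measure coin_space (\<Union>s. ?B s)"
    by (intro coin.finite_Lim_measure_incseq) (use B in \<open>auto simp: incseq_def\<close>)
  moreover have "(\<Union>s. ?B s) = K \<inter> {\<omega>. runs (char_fun (Collect \<omega>)) p xs y}"
  proof -
    have "(\<exists>s. \<forall>t\<in>{s..}. eval_bound h t p xs = Suc y) \<longleftrightarrow> runs h p xs y" for h
      using eval_bound_sound[of h _ p xs y] eval_bound_complete[of h p xs y]
      unfolding eventually_sequentially by (meson atLeast_iff order_refl)
    then show ?thesis by (auto simp del: atLeast_iff)
  qed
  ultimately have "eventually (\<lambda>s. c < measure coin_space (?B s)) sequentially"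
    using c by (intro order_tendstoD(1)) auto
  then show ?thesis
  proof eventually_elim
    case (elim s)
    have "measure coin_space (?B s) \<le> measure coin_space (K \<inter> ?E s)"
      by (intro coin.finite_measure_mono) auto
    with elim show ?case by simp
  qed
qed

lemma eff_dense_computable_if_not_null:
  assumes pos: "measure coin_space (Collect -` desc_class p f) > 0"
  shows "eff_dense_computable f"
proof -
  let ?C = "Collect -` desc_class p f"
  let ?W = "\<lambda>m v. {\<omega>. runs (char_fun (Collect \<omega>)) p [m] v}"
  let ?e = "\<lambda>\<omega> s m. eval_bound (char_fun (Collect \<omega>)) s p [m]"
  have C[measurable]: "?C \<in> sets coin_space" by (rule sets_desc_class)
  obtain l K where K: "depends_below l K" and Kpos: "measure coin_space K > 0"
    and KC: "measure coin_space (K - ?C) < measure coin_space K / 8"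
    using clopen_concentration[OF C pos] by blast
  define \<kappa> where "\<kappa> = measure coin_space K"
  have K_sets[measurable]: "K \<in> sets coin_space" by (rule sets_depends_below[OF K])
  have W[measurable]: "?W m v \<in> sets coin_space" for m v by (rule sets_runs)
  define a where "a = card {\<tau>::nat. \<tau> < 2 ^ l \<and> bit \<tau> \<in> K}"
  have \<kappa>: "\<kappa> = real a / 2 ^ l" unfolding \<kappa>_def a_def by (rule measure_depends_below[OF K])
  \<comment> \<open>This is \<open>R_iff\<close> cleared of denominators, with \<open>a\<close> the
    numerator of \<open>\<kappa>\<close> over \<open>2 ^ l\<close>. The bound \<open>s + l\<close>
    ensures that the strings are long enough to decide membership in \<open>K\<close>.\<close>
  define R where "R v s n \<longleftrightarrow>
    a * 2 ^ s < 4 * (\<Sum>\<tau><2 ^ (s + l). of_bool (bit (\<tau>::nat) \<in> K \<and> ?e (bit \<tau>) (s + l) n = Suc v))" for v s n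
  have R_iff: "R v s n \<longleftrightarrow> \<kappa> / 4 < measure coin_space (K \<inter> {\<omega>. ?e \<omega> (s + l) n = Suc v})" for v s n
  proof -
    let ?B = "K \<inter> {\<omega>. ?e \<omega> (s + l) n = Suc v}"
    have "depends_below (s + l) ?B"
      by (intro depends_below_Int depends_below_eval_bound depends_below_mono[OF K]) simp
    from measure_depends_below[OF this]
    have "measure coin_space ?B = real (card ({\<tau>::nat. bit \<tau> \<in> ?B} \<inter> {..<2 ^ (s + l)})) / 2 ^ (s + l)"
      by (simp add: Int_def conj_commute)
    also have "\<dots> = real (\<Sum>\<tau><2 ^ (s + l). of_bool (bit (\<tau>::nat) \<in> K \<and> ?e (bit \<tau>) (s + l) n = Suc v)) / 2 ^ (s + l)"
      unfolding card_inter_lessThan by simp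
    finally have m: "measure coin_space ?B =
      real (\<Sum>\<tau><2 ^ (s + l). of_bool (bit (\<tau>::nat) \<in> K \<and> ?e (bit \<tau>) (s + l) n = Suc v)) / 2 ^ (s + l)" .
    have "\<kappa> / 4 < real N / 2 ^ (s + l) \<longleftrightarrow> a * 2 ^ s < 4 * N" for N
    proof -
      have "\<kappa> / 4 < real N / 2 ^ (s + l) \<longleftrightarrow> real (a * 2 ^ s) < real (4 * N)"
        unfolding \<kappa> by (simp add: field_simps power_add)
      then show ?thesis by (simp only: of_nat_less_iff)
    qed
    then show ?thesis unfolding R_def m by blast
  qed
  have R_sound: "\<kappa> / 8 < measure coin_space (?C \<inter> ?W n v)" if "R v s n" for v s n
  proof -
    have "\<kappa> / 4 < measure coin_space (K \<inter> {\<omega>. ?e \<omega> (s + l) n = Suc v})" using that R_iff by blast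
    also have "\<dots> \<le> measure coin_space ((?C \<inter> ?W n v) \<union> (K - ?C))"
      by (intro coin.finite_measure_mono) (auto intro: eval_bound_sound)
    also have "\<dots> \<le> measure coin_space (?C \<inter> ?W n v) + measure coin_space (K - ?C)"
      by (intro measure_Un_le) auto
    finally show ?thesis using KC unfolding \<kappa>_def by simp
  qed
  have R_ex: "\<exists>s. \<exists>v<s. R v s n" for n
  proof -
    have "measure coin_space K \<le>
        measure coin_space ((K \<inter> ?W n 0) \<union> (K \<inter> ?W n (Suc (f n))) \<union> (K - ?C))"
      by (intro coin.finite_measure_mono) (auto simp: desc_class_iff)
    also have "\<dots> \<le> measure coin_space ((K \<inter> ?W n 0) \<union> (K \<inter> ?W n (Suc (f n)))) + measure coin_space (K - ?C)"
      by (intro measure_Un_le) auto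
    also have "\<dots> \<le> measure coin_space (K \<inter> ?W n 0) + measure coin_space (K \<inter> ?W n (Suc (f n))) + measure coin_space (K - ?C)"
      by (intro add_right_mono measure_Un_le) auto
    \<comment> \<open>If both shares were at most a quarter, they and the bad part would cover less
      than 5/8 of \<open>K\<close>.\<close>
    finally have "\<kappa> / 4 < measure coin_space (K \<inter> ?W n 0) \<or> \<kappa> / 4 < measure coin_space (K \<inter> ?W n (Suc (f n)))"
      using KC Kpos unfolding \<kappa>_def by linarith
    then obtain v where "\<kappa> / 4 < measure coin_space (K \<inter> ?W n v)" by blast
    from measure_runs_stage[OF K this]
    \<comment> \<open>Requiring \<open>v + l < s\<close> makes \<open>t - l\<close> a legitimate
      stage that also exceeds the value \<open>v\<close>, as the search demands.\<close>
    have "eventually (\<lambda>s. \<kappa> / 4 < measure coin_space (K \<inter> {\<omega>. ?e \<omega> s n = Suc v}) \<and> v + l < s) sequentially"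
      using eventually_gt_at_top by (rule eventually_conj)
    then obtain t where t: "\<kappa> / 4 < measure coin_space (K \<inter> {\<omega>. ?e \<omega> t n = Suc v})" "v + l < t"
      using eventually_happens'[OF sequentially_bot] by blast
    then have "R v (t - l) n" "v < t - l" unfolding R_iff by auto
    then show ?thesis by blast
  qed
  \<comment> \<open>Oracle values are now read off the number \<open>\<tau>\<close>. The flag
    \<open>False\<close> records that the resulting program asks no queries.\<close>
  have bit_rec: "total_rec False 2 (\<lambda>g ys. of_bool (bit (ys ! 0) (ys ! 1)))"
    by (intro decidable_rel_bit total_rec_proj) auto
  \<comment> \<open>The arguments are \<open>[\<tau>, v, s, n]\<close>, the string being put in
    front of \<open>[v, s, n]\<close> by the sum.\<close>
  have "total_rec False 4 (\<lambda>g zs. eval_bound (\<lambda>x. of_bool (bit (zs ! 0) x)) (zs ! 2 + l) p [zs ! 3])"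
    by (rule total_rec_eval_bound_unary[of False "\<lambda>g u x. of_bool (bit u x)", OF bit_rec];
        intro total_rec_add total_rec_const total_rec_proj; simp)
  moreover have "decidable_rel False 4 (\<lambda>g zs. bit (zs ! 0) \<in> K)"
    by (rule decidable_rel_finite_use[of l "\<lambda>\<omega>. \<omega> \<in> K"])
      (use K in \<open>auto simp: depends_below_def intro: total_rec_proj\<close>)
  ultimately have "decidable_rel False (Suc 3) (\<lambda>g zs. bit (zs ! 0) \<in> K \<and> ?e (bit (zs ! 0)) (zs ! 2 + l) (zs ! 3) = Suc (zs ! 1))"
    unfolding char_fun_Collect
    by (intro decidable_rel_conj decidable_rel_eq total_rec_Suc total_rec_proj) auto
  then have "decidable_rel False 3 (\<lambda>g ys. a * 2 ^ (ys ! 1) < 4 * (\<Sum>\<tau><2 ^ (ys ! 1 + l).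
      (\<lambda>g zs. of_bool (bit (zs ! 0) \<in> K \<and> ?e (bit (zs ! 0)) (zs ! 2 + l) (zs ! 3) = Suc (zs ! 1))) g (\<tau> # ys)))"
    by (intro decidable_rel_less total_rec_mult total_rec_sum total_rec_power total_rec_add
        total_rec_const total_rec_proj) auto
  then have "decidable_rel False 3 (\<lambda>g ys. R (ys ! 0) (ys ! 1) (ys ! 2))"
    by (simp add: R_def)
  from total_rec_search[OF this R_ex]
  obtain V where V_rec: "total_rec False 1 (\<lambda>g xs. V (xs ! 0))" and V: "\<forall>n. \<exists>s. R (V n) s n"
    by blast
  have V_meas: "\<kappa> / 8 < measure coin_space (?C \<inter> ?W n (V n))" for n
    using V R_sound by blast
  have V_val: "V n = 0 \<or> V n = Suc (f n)" for n
  proof -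
    have "?C \<inter> ?W n (V n) \<noteq> {}"
    proof
      assume "?C \<inter> ?W n (V n) = {}"
      then have "measure coin_space (?C \<inter> ?W n (V n)) = 0" by simp
      then show False using V_meas[of n] Kpos unfolding \<kappa>_def by linarith
    qed
    then obtain \<omega> where "Collect \<omega> \<in> desc_class p f" "runs (char_fun (Collect \<omega>)) p [n] (V n)"
      by blast
    then show ?thesis unfolding desc_class_iff by (blast dest: runs_deterministic)
  qed
  define Z where "Z = {n. V n = 0}"
  \<comment> \<open>Intersecting with \<open>?C\<close> makes the average vanish off the class, so
    it tends to 0 at every point and the constant 1 dominates it.\<close>
  define u where "u n \<omega> = (\<Sum>m<n. indicator (?C \<inter> ?W m 0) \<omega> :: real) / real n" for n \<omega>
  have u_meas[measurable]: "u n \<in> borel_measurable coin_space" for n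
    unfolding u_def by measurable
  have u_lim: "(\<lambda>n. u n \<omega>) \<longlonglongrightarrow> 0" for \<omega>
  proof (cases "\<omega> \<in> ?C")
    case True
    then have "u n \<omega> = real (card ({m. runs (char_fun (Collect \<omega>)) p [m] 0} \<inter> {..<n})) / real n" for n
      unfolding u_def card_inter_lessThan by (simp add: indicator_def of_bool_def if_distrib[of real] cong: if_cong)
    then show ?thesis using True by (simp add: desc_class_iff)
  next
    case False
    then show ?thesis by (simp add: u_def)
  qed
  have u_bound: "norm (u n \<omega>) \<le> 1" for n \<omega>
  proof -
    have "(\<Sum>m<n. indicator (?C \<inter> ?W m 0) \<omega> :: real) \<le> (\<Sum>m<n. 1)"
      by (rule sum_mono) (simp add: indicator_def)
    then have "u n \<omega> \<le> 1" unfolding u_def by (cases "n = 0") (auto simp: divide_le_eq)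
    moreover have "0 \<le> u n \<omega>" unfolding u_def by (intro divide_nonneg_nonneg sum_nonneg) auto
    ultimately show ?thesis by simp
  qed
  have "(\<lambda>n. integral\<^sup>L coin_space (u n)) \<longlonglongrightarrow> integral\<^sup>L coin_space (\<lambda>_. 0)"
    by (rule integral_dominated_convergence[where w = "\<lambda>_. 1"]) (use u_lim u_bound in auto)
  then have lim: "(\<lambda>n. integral\<^sup>L coin_space (u n)) \<longlonglongrightarrow> 0" by simp
  have lower: "\<kappa> / 8 * (real (card (Z \<inter> {..<n})) / real n) \<le> integral\<^sup>L coin_space (u n)" for n
  proof -
    have "integral\<^sup>L coin_space (u n) = (\<Sum>m<n. measure coin_space (?C \<inter> ?W m 0)) / real n"
    proof -
      have "integrable coin_space (indicator (?C \<inter> ?W m 0) :: _ \<Rightarrow> real)" for m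
        by (intro integrable_real_indicator) (auto simp: coin.emeasure_eq_measure)
      then have "integral\<^sup>L coin_space (\<lambda>\<omega>. \<Sum>m<n. indicator (?C \<inter> ?W m 0) \<omega> :: real)
          = (\<Sum>m<n. measure coin_space (?C \<inter> ?W m 0))"
        by (subst Bochner_Integration.integral_sum) (auto simp: space_coin)
      then show ?thesis unfolding u_def by simp
    qed
    \<comment> \<open>By \<open>V_meas\<close>, every input in \<open>Z\<close> contributes more
      than \<open>\<kappa> / 8\<close> to the sum; the other terms are nonnegative.\<close>
    moreover have "\<kappa> / 8 * real (card (Z \<inter> {..<n})) \<le> (\<Sum>m<n. measure coin_space (?C \<inter> ?W m 0))"
    proof -
      have "\<kappa> / 8 * real (card (Z \<inter> {..<n})) = (\<Sum>m<n. \<kappa> / 8 * of_bool (m \<in> Z))"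
        by (simp only: card_inter_lessThan of_nat_sum of_nat_of_bool sum_distrib_left)
      also have "\<dots> \<le> (\<Sum>m<n. measure coin_space (?C \<inter> ?W m 0))"
      proof (rule sum_mono)
        fix m show "\<kappa> / 8 * of_bool (m \<in> Z) \<le> measure coin_space (?C \<inter> ?W m 0)"
          using V_meas[of m] by (cases "m \<in> Z") (auto simp: Z_def)
      qed
      finally show ?thesis .
    qed
    ultimately show ?thesis
      by (simp only: times_divide_eq_right divide_right_mono of_nat_0_le_iff)
  qed
  have "(\<lambda>n. \<kappa> / 8 * (real (card (Z \<inter> {..<n})) / real n)) \<longlonglongrightarrow> 0"
  proof (rule tendsto_sandwich[OF _ _ tendsto_const lim])
    show "eventually (\<lambda>n. 0 \<le> \<kappa> / 8 * (real (card (Z \<inter> {..<n})) / real n)) sequentially"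
      using Kpos unfolding \<kappa>_def by simp
  qed (use lower in simp)
  from tendsto_mult_left[OF this, of "8 / \<kappa>"]
  have dens: "(\<lambda>n. real (card (Z \<inter> {..<n})) / real n) \<longlonglongrightarrow> 0"
    using Kpos unfolding \<kappa>_def by simp
  define d where "d n = (if V n = 0 then None else Some (V n - 1))" for n
  have "code_desc d = V" by (rule ext) (simp add: code_desc_def d_def)
  then have comp: "computable (code_desc d)" using computable_total_rec[OF V_rec] by simp
  have "{n. d n \<noteq> None} = {n. n \<notin> Z}" by (auto simp: d_def Z_def)
  then have "has_density {n. d n \<noteq> None} 1" using dens by (simp only: has_density_one_iff)
  moreover have "d n = Some (f n)" if "d n \<noteq> None" for n
    using V_val[of n] that by (auto simp: d_def)
  ultimately have "eff_dense_desc f d" unfolding eff_dense_desc_def by blast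
  with comp show ?thesis unfolding eff_dense_computable_def by blast
qed

lemma null_desc_class:
  assumes "\<not> eff_dense_computable f"
  shows "desc_class p f \<in> null_sets cantor_measure"
proof (rule null_sets_cantor)
  have "measure coin_space (Collect -` desc_class p f) = 0"
    using eff_dense_computable_if_not_null[of p f] assms
      measure_nonneg[of coin_space "Collect -` desc_class p f"] by linarith
  then show "Collect -` desc_class p f \<in> null_sets coin_space"
    using sets_desc_class by (intro null_setsI) (simp_all add: coin.emeasure_eq_measure)
qed

lemma null_eff_dense_computable_in:
  assumes "\<not> eff_dense_computable f"
  shows "{X. eff_dense_computable_in X f} \<in> null_sets cantor_measure"
proof (rule null_sets_cantor_subset)
  show "{X. eff_dense_computable_in X f} \<subseteq> (\<Union>p. desc_class p f)"
    using eff_dense_computable_in_desc_class by blast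
  show "(\<Union>p. desc_class p f) \<in> null_sets cantor_measure"
    by (intro null_sets_UN null_desc_class assms)
qed

text \<open>A total function is an effective dense description of itself. It suffices to apply the
  reduction to this one description of \<open>X\<close>, which \<open>X\<close> computes.\<close>

lemma ned_le_imp_eff_dense_computable_in:
  assumes "h \<le>\<^sub>n\<^sub>e\<^sub>d char_fun X"
  shows "eff_dense_computable_in X h"
proof -
  let ?d = "\<lambda>n. Some (char_fun X n)"
  have "(\<lambda>n. real (card ({} \<inter> {..<n})) / real n) \<longlonglongrightarrow> 0" by simp
  then have "has_density {n. n \<notin> {}} 1" unfolding has_density_one_iff .
  then have "eff_dense_desc (char_fun X) ?d" by (simp add: eff_dense_desc_def)
  then obtain d' where d': "eff_dense_desc h d'" "computable_in (code_desc ?d) (code_desc d')"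
    using assms unfolding ned_le_def by blast
  \<comment> \<open>As \<open>code_desc\<close> reserves 0 for a missing value, the code of this
    description is the characteristic function plus one: a query followed by a successor.\<close>
  have "computes (char_fun X) (PComp PSucc [PQuery]) (code_desc ?d)"
    unfolding computes_def code_desc_def by (auto intro!: runs.comp runs.query runs.succ)
  then have "computable_in (char_fun X) (code_desc d')"
    using d'(2) computable_in_trans unfolding computable_in_def by blast
  with d'(1) show ?thesis unfolding eff_dense_computable_in_def by blast
qed

lemma ued_le_imp_ned_le: "h \<le>\<^sub>u\<^sub>e\<^sub>d g \<Longrightarrow> h \<le>\<^sub>n\<^sub>e\<^sub>d g"
  unfolding ued_le_def ned_le_def computable_in_def by blast

theorem theorem6p5:
  fixes f :: "nat \<Rightarrow> nat" and A :: "nat set"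
  shows "(\<not> eff_dense_computable f \<longrightarrow>
            {X. eff_dense_computable_in X f} \<in> null_sets cantor_measure \<and>
            (\<forall>X. eff_dense_computable_in X f \<longrightarrow> \<not> weakly_random 3 f X)) \<and>
         (\<not> eff_dense_computable (char_fun A) \<longrightarrow>
            {X. char_fun A \<le>\<^sub>u\<^sub>e\<^sub>d char_fun X} \<in> null_sets cantor_measure \<and>
            {X. char_fun A \<le>\<^sub>n\<^sub>e\<^sub>d char_fun X} \<in> null_sets cantor_measure)"
proof (intro conjI impI allI)
  assume "\<not> eff_dense_computable f"
  then show "{X. eff_dense_computable_in X f} \<in> null_sets cantor_measure"
    by (rule null_eff_dense_computable_in)
next
  fix X assume f: "\<not> eff_dense_computable f" and "eff_dense_computable_in X f"
  then obtain p where "X \<in> desc_class p f" using eff_dense_computable_in_desc_class by blast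
  then show "\<not> weakly_random 3 f X"
    unfolding weakly_random_def using Pi_class_desc_class null_desc_class[OF f] by blast
next
  assume A: "\<not> eff_dense_computable (char_fun A)"
  have sub: "{X. char_fun A \<le>\<^sub>n\<^sub>e\<^sub>d char_fun X} \<subseteq> {X. eff_dense_computable_in X (char_fun A)}"
    using ned_le_imp_eff_dense_computable_in by blast
  show ned: "{X. char_fun A \<le>\<^sub>n\<^sub>e\<^sub>d char_fun X} \<in> null_sets cantor_measure"
    by (rule null_sets_cantor_subset[OF sub null_eff_dense_computable_in[OF A]])
  show "{X. char_fun A \<le>\<^sub>u\<^sub>e\<^sub>d char_fun X} \<in> null_sets cantor_measure"
    by (rule null_sets_cantor_subset[OF _ ned]) (auto dest: ued_le_imp_ned_le)
qed

end
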